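(* Let $H$ be a strictly $2$-balanced graph with at least five edges and $m_2(H) > 1$. Suppose that every graph $G$ with $m(G) \le m_2(H)$ satisfies $G \not\xrightarrow{\mathrm{a-ram}} H$. Then there exists a constant $c > 0$ such that if $p = p(n) \le c\, n^{-1/m_2(H)}$ then $\lim_{n\to\infty}\mathbb{P}\big[G(n,p) \xrightarrow{\mathrm{a-ram}} H\big] = 0$.
   Context: $G(n,p)$ is the random graph on $n$ vertices with each edge present independently with probability $p$. A graph $G$ has the anti-Ramsey property for $H$, written $G \xrightarrow{\mathrm{a-ram}} H$, if every proper edge-colouring of $G$ contains a rainbow copy of $H$ (a subgraph isomorphic to $H$ whose edges have pairwise distinct colours); $G \not\xrightarrow{\mathrm{a-ram}} H$ means this fails. For a graph $G$, $m(G) = \max\{e(J)/v(J) : J \subseteq G,\ v(J) \ge 1\}$. For a graph $J$, $d_2(J) = \frac{e(J)-1}{v(J)-2}$ if $e(J)\ge 1$ and $v(J)\ge 3$, $d_2(K_2) = 1/2$, and $d_2(J)=0$ otherwise; $m_2(H) = \max\{d_2(J) : J \subseteq H\}$. $H$ is strictly $2$-balanced if $d_2(J) < d_2(H)$ for every proper subgraph $J \subsetneq H$. *)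

theory Defs
  imports "HOL-Probability.Probability"
begin

datatype 'a sgraph = SGraph (verts: "'a set") (edges: "'a set set")

definition finite_simple_graph :: "'a sgraph \<Rightarrow> bool" where
  "finite_simple_graph G \<longleftrightarrow>
     finite (verts G) \<and> (\<forall>e\<in>edges G. e \<subseteq> verts G \<and> card e = 2)"

definition subgraph :: "'a sgraph \<Rightarrow> 'a sgraph \<Rightarrow> bool" where
  "subgraph J G \<longleftrightarrow>
     finite_simple_graph J \<and> verts J \<subseteq> verts G \<and> edges J \<subseteq> edges G"

definition isomorphic :: "'a sgraph \<Rightarrow> 'b sgraph \<Rightarrow> bool" where
  "isomorphic G H \<longleftrightarrow>
     (\<exists>f. bij_betw f (verts G) (verts H) \<and> edges H = (\<lambda>e. f ` e) ` edges G)"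

(* Natural numbers suffice as colours, since only finite graphs are coloured. *)
definition proper_edge_colouring :: "'a sgraph \<Rightarrow> ('a set \<Rightarrow> nat) \<Rightarrow> bool" where
  "proper_edge_colouring G col \<longleftrightarrow>
     (\<forall>e\<in>edges G. \<forall>e'\<in>edges G. e \<noteq> e' \<and> e \<inter> e' \<noteq> {} \<longrightarrow> col e \<noteq> col e')"

definition anti_ramsey :: "'a sgraph \<Rightarrow> 'b sgraph \<Rightarrow> bool" where
  "anti_ramsey G H \<longleftrightarrow>
     (\<forall>col. proper_edge_colouring G col \<longrightarrow>
        (\<exists>J. subgraph J G \<and> isomorphic J H \<and> inj_on col (edges J)))"

(* For the graph without vertices the maximum is over the empty set, so its value is
   unspecified; that graph contains no copy of a graph with an edge. *)
definition max_density :: "'a sgraph \<Rightarrow> real" where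
  "max_density G =
     Max {real (card (edges J)) / real (card (verts J)) | J.
            subgraph J G \<and> card (verts J) \<ge> 1}"

(* The second case is the graph with two vertices and one edge. *)
definition d2 :: "'a sgraph \<Rightarrow> real" where
  "d2 J =
     (if card (edges J) \<ge> 1 \<and> card (verts J) \<ge> 3
        then (real (card (edges J)) - 1) / (real (card (verts J)) - 2)
      else if card (edges J) = 1 \<and> card (verts J) = 2 then 1 / 2
      else 0)"

definition m2 :: "'a sgraph \<Rightarrow> real" where
  "m2 H = Max {d2 J | J. subgraph J H}"

definition strictly_2_balanced :: "'a sgraph \<Rightarrow> bool" where
  "strictly_2_balanced H \<longleftrightarrow> (\<forall>J. subgraph J H \<and> J \<noteq> H \<longrightarrow> d2 J < d2 H)"

definition potential_edges :: "nat \<Rightarrow> nat set set" where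
  "potential_edges n = {e. e \<subseteq> {..<n} \<and> card e = 2}"

definition random_graph :: "nat \<Rightarrow> real \<Rightarrow> nat sgraph pmf" where
  "random_graph n p =
     map_pmf (\<lambda>\<omega>. SGraph {..<n} {e \<in> potential_edges n. \<omega> e})
       (Pi_pmf (potential_edges n) False (\<lambda>_. bernoulli_pmf p))"

end

theory Submission imports Defs
begin

text \<open>Suppose a sample of \<open>G(n,p)\<close> forces a rainbow copy of \<open>H\<close> and let \<open>E\<close> be an edge-minimal
  forcing subset of it. Two disjoint edges of a copy that lie in no other copy could share a fresh
  colour, so in \<open>E\<close> every copy shares at least three of its edges with other copies, and \<open>E\<close> is
  connected through copies; by hypothesis \<open>E\<close> also has a subset of density above \<open>m\<^sub>2(H)\<close>.
  Explore \<open>E\<close> copy by copy. A new copy meeting the explored part in just one edge costs a factor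
  that is a small constant, since \<open>n\<^bsup>v-2\<^esup> p\<^bsup>e-1\<^esup> \<le> c\<^bsup>e-1\<^esup>\<close>; any other overlap costs
  \<open>n\<^bsup>-\<epsilon>\<^esup>\<close> up to logarithms, by strict balancedness. Call a copy live if it is attached to the
  rest of the explored part along one edge only. A live copy has at least two further shared edges,
  and attaching regular copies at both increases the number of live copies, whereas a degenerate
  step destroys only boundedly many. Hence the exploration makes many degenerate steps, or
  lasts for \<open>ln n\<close> regular rounds, or \<open>E\<close> has bounded size; a union bound excludes the first
  two outcomes, and the third because bounded graphs denser than \<open>m\<^sub>2(H)\<close> do not appear.\<close>

section \<open>Copies of a strictly balanced graph\<close>

text \<open>The obstacle is that a regular attachment costs only a constant factor while the first
  copy contributes about \<open>n^2\<close>, so counting regular rounds becomes effective only after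
  order ln n of them. An exploration could end earlier, at a size unbounded in n, where the count
  says too little. The balance of live copies closes this gap: a regular round gains one, a
  degenerate round loses at most \<open>card (\<Union>H)\<close>, so an exploration that ends
  without live copies after boundedly many degenerate rounds has also made boundedly many regular
  ones. The balance rests on rigidity (\<open>glue_unique\<close>): gluing a copy along one edge
  creates no copy besides itself, so the shared edges of a live copy must lead out of the explored
  part. The proof of this adds up the strict density inequalities of two parts of a copy. The number
  3 in \<open>exp (- 3)\<close> and in \<open>3 / \<epsilon>\<close> beats the initial
  \<open>n^2\<close> and leaves \<open>1 / n\<close> to absorb all logarithms.\<close>

locale pattern =
  fixes H :: "'a set set" and m :: real
  assumes finite_H: "finite H"
    and edge_card: "e \<in> H \<Longrightarrow> card e = 2"
    and five_edges: "5 \<le> card H"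
    and m_gt_1: "1 < m"
    and density_H: "real (card H) - 1 = m * (real (card (\<Union>H)) - 2)"
    and density_less:
      "A \<subset> H \<Longrightarrow> 2 \<le> card A \<Longrightarrow> real (card A) - 1 < m * (real (card (\<Union>A)) - 2)"
begin

text \<open>A copy is a bare edge set. This loses nothing, because a strictly balanced graph has no
  isolated vertices (\<open>pattern_of_graph\<close>), and it lets explored sets be plain unions of
  copies.\<close>

definition copies :: "nat set set set" where
  "copies = {C. \<exists>\<phi>. inj_on \<phi> (\<Union>H) \<and> C = (\<lambda>e. \<phi> ` e) ` H}"

lemma finite_Union_H: "finite (\<Union>H)"
proof (rule finite_Union[OF finite_H])
  show "finite e" if "e \<in> H" for e using edge_card[OF that] by (metis card.infinite zero_neq_numeral)
qed

lemma copyE: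
  assumes "C \<in> copies"
  obtains \<phi> where "inj_on \<phi> (\<Union>H)" "C = (\<lambda>e. \<phi> ` e) ` H"
  using assms by (auto simp: copies_def)

lemma copy_subset_image:
  assumes "inj_on \<phi> (\<Union>H)" "A \<subseteq> H"
  shows "card ((\<lambda>e. \<phi> ` e) ` A) = card A"
    and "card (\<Union>((\<lambda>e. \<phi> ` e) ` A)) = card (\<Union>A)"
proof -
  have "inj_on (\<lambda>e. \<phi> ` e) A"
    using inj_on_image[of \<phi> A] assms by (meson Union_mono inj_on_subset)
  then show "card ((\<lambda>e. \<phi> ` e) ` A) = card A" by (rule card_image)
  have "\<Union>((\<lambda>e. \<phi> ` e) ` A) = \<phi> ` \<Union>A" by blast
  moreover have "inj_on \<phi> (\<Union>A)" using assms by (meson Union_mono inj_on_subset)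
  ultimately show "card (\<Union>((\<lambda>e. \<phi> ` e) ` A)) = card (\<Union>A)" by (simp add: card_image)
qed

lemma finite_copy: "C \<in> copies \<Longrightarrow> finite C"
  using finite_H by (auto elim: copyE)

lemma card_copy: "C \<in> copies \<Longrightarrow> card C = card H"
  by (auto elim!: copyE simp: copy_subset_image(1))

lemma card_Union_copy: "C \<in> copies \<Longrightarrow> card (\<Union>C) = card (\<Union>H)"
  by (metis copyE copy_subset_image(2) subset_refl)

lemma card_edge_copy:
  assumes "C \<in> copies" "e \<in> C" shows "card e = 2"
proof -
  obtain \<phi> where \<phi>: "inj_on \<phi> (\<Union>H)" "C = (\<lambda>e. \<phi> ` e) ` H" using assms(1) by (rule copyE)
  then obtain e' where e': "e' \<in> H" "e = \<phi> ` e'" using assms(2) by blast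
  moreover have "inj_on \<phi> e'" using \<phi>(1) e'(1) by (meson Union_upper inj_on_subset)
  ultimately show ?thesis using edge_card by (simp add: card_image)
qed

lemma finite_edge_copy: "C \<in> copies \<Longrightarrow> e \<in> C \<Longrightarrow> finite e"
  using card_edge_copy by (metis card.infinite zero_neq_numeral)

lemma finite_Union_copy: "C \<in> copies \<Longrightarrow> finite (\<Union>C)"
  using finite_copy finite_edge_copy by blast

lemma finite_Union_sub_copy: "C \<in> copies \<Longrightarrow> A \<subseteq> C \<Longrightarrow> finite (\<Union>A)"
  using finite_Union_copy by (meson Union_mono finite_subset)

lemma density_copy: "C \<in> copies \<Longrightarrow> real (card C) - 1 = m * (real (card (\<Union>C)) - 2)"
  using density_H by (simp add: card_copy card_Union_copy)

lemma density_copy_less: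
  assumes "C \<in> copies" "A \<subset> C" "2 \<le> card A"
  shows "real (card A) - 1 < m * (real (card (\<Union>A)) - 2)"
proof -
  obtain \<phi> where \<phi>: "inj_on \<phi> (\<Union>H)" "C = (\<lambda>e. \<phi> ` e) ` H" using assms(1) by (rule copyE)
  define A' where "A' = {e \<in> H. \<phi> ` e \<in> A}"
  have A: "A = (\<lambda>e. \<phi> ` e) ` A'" using assms(2) \<phi>(2) by (auto simp: A'_def)
  have "A' \<subseteq> H" by (simp add: A'_def)
  moreover have "A' \<noteq> H" using assms(2) A \<phi>(2) by blast
  ultimately show ?thesis
    using density_less[of A'] assms(3) copy_subset_image[OF \<phi>(1), of A', folded A]
    by (simp add: psubset_eq)
qed

text \<open>Equality holds for the whole copy and for a single edge, the two cases that the strict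
  bound leaves out.\<close>

lemma density_copy_le:
  assumes "C \<in> copies" "A \<subseteq> C" "A \<noteq> {}"
  shows "real (card A) - 1 \<le> m * (real (card (\<Union>A)) - 2)"
proof -
  have fin: "finite A" using assms finite_copy finite_subset by blast
  consider "A = C" | "card A = 1" | "A \<subset> C" "2 \<le> card A"
  proof -
    have "card A \<noteq> 0" using fin assms(3) by simp
    then have "card A = 1 \<or> 2 \<le> card A" by linarith
    then show thesis using that assms(2) by blast
  qed
  then show ?thesis
  proof cases
    case 2
    then obtain e where "A = {e}" by (auto simp: card_1_singleton_iff)
    then show ?thesis using assms card_edge_copy by auto
  next
    case 1 then show ?thesis using density_copy[OF assms(1)] by simp
  next
    case 3 then show ?thesis using density_copy_less[OF assms(1), of A] by linarith
  qed
qed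

lemma v_ge_4: "4 \<le> card (\<Union>H)"
proof (rule ccontr)
  assume *: "\<not> 4 \<le> card (\<Union>H)"
  have "H \<subseteq> {e. e \<subseteq> \<Union>H \<and> card e = 2}" using edge_card by blast
  then have "card H \<le> card (\<Union>H) choose 2"
    using card_mono[of "{e. e \<subseteq> \<Union>H \<and> card e = 2}" H] finite_Union_H
    unfolding n_subsets[OF finite_Union_H, of 2] by simp
  also have "\<dots> \<le> 3"
  proof -
    have "card (\<Union>H) * (card (\<Union>H) - 1) \<le> 3 * 2" using * by (intro mult_le_mono) auto
    then show ?thesis by (simp add: choose_two)
  qed
  finally show False using five_edges by simp
qed

text \<open>D is cut at f into a part A inside C and a part B in the rest, which meet only within f.
  If D were a copy other than C, the density bounds for the two parts would add up to fewer edges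
  than H has. Hence attaching a copy along one edge creates no second new copy.\<close>

lemma glue_unique:
  assumes C: "C \<in> copies" and D: "D \<in> copies"
    and f: "f \<in> C" and glue: "\<Union>C \<inter> \<Union>R \<subseteq> f"
    and sub: "D \<subseteq> R \<union> C" and g: "g \<in> D" "g \<in> C" "g \<noteq> f"
  shows "D = C"
proof -
  define A where "A = D \<inter> (C - {f})"
  define B where "B = D - A"
  have fin: "finite D" "finite C" "finite (\<Union>C)" "finite (\<Union>D)" "finite f"
    using C D f finite_copy finite_Union_copy finite_edge_copy by auto
  have DAB: "D = A \<union> B" "A \<inter> B = {}" by (auto simp: A_def B_def)
  have finAB: "finite A" "finite B" using fin by (auto simp: A_def B_def)
  have finU: "finite (\<Union>A)" "finite (\<Union>B)"
    using DAB finite_Union_sub_copy[OF D] by auto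
  have B_cases: "h \<in> R \<or> h = f" if "h \<in> B" for h
    using that sub by (auto simp: A_def B_def)
  have cardD: "card A + card B = card H"
    using card_Un_disjoint[OF finAB DAB(2)] DAB(1) card_copy[OF D] by simp
  have card2f: "card f = 2" using C f card_edge_copy by blast
  have interB: "\<Union>C \<inter> \<Union>B \<subseteq> f" 
  proof
    fix x assume "x \<in> \<Union>C \<inter> \<Union>B"
    then obtain h where h: "x \<in> \<Union>C" "h \<in> B" "x \<in> h" by blast
    then show "x \<in> f" using B_cases[OF h(2)] glue by blast
  qed
  have gA: "g \<in> A" using g by (simp add: A_def)
  have cardCf: "card (C - {f}) = card H - 1" using f fin card_copy[OF C] by simp
  have AC: "A \<subseteq> C - {f}" by (auto simp: A_def)
  have vD: "card (\<Union>D) = card (\<Union>H)" "card (\<Union>C) = card (\<Union>H)"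
    using C D card_Union_copy by auto
  have Un: "\<Union>D = \<Union>A \<union> \<Union>B" using DAB by blast
  show ?thesis
  proof (cases "A = C - {f}")
    case True
    \<comment> \<open>Only one edge h of D is missing from A. Since m > 1, removing a single edge
      cannot remove a vertex, so A already spans D; thus h lies in C and in
      \<open>\<Union>B\<close>, that is, inside f.\<close>
    then have "card B = 1" using cardD cardCf five_edges by auto
    then obtain h where h: "B = {h}" by (auto simp: card_1_singleton_iff)
    have "real (card A) - 1 \<le> m * (real (card (\<Union>A)) - 2)"
      using density_copy_le[OF D, of A] gA DAB by auto
    moreover have "real (card A) = real (card H) - 1" using True cardCf five_edges by auto
    ultimately have "m * (real (card (\<Union>H)) - 2) - 1 \<le> m * (real (card (\<Union>A)) - 2)"
      using density_H by simp
    then have "m * (real (card (\<Union>H)) - real (card (\<Union>A))) < m * 1"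
      using m_gt_1 by (simp add: algebra_simps)
    then have "card (\<Union>H) \<le> card (\<Union>A)"
      using m_gt_1 by (subst (asm) mult_less_cancel_left_pos) auto
    then have "\<Union>A = \<Union>D" using vD Un fin by (intro card_seteq) auto
    moreover have "\<Union>A \<subseteq> \<Union>C" using AC by auto
    ultimately have "h \<subseteq> f" using interB h Un by auto
    moreover have "card h = 2" using h DAB D card_edge_copy by blast
    ultimately have "h = f" using card2f fin(5) by (metis card_subset_eq)
    then show ?thesis using True h DAB f by auto
  next
    case False
    then have psub: "A \<subset> C - {f}" using AC by blast
    then have "card A < card H - 1" using cardCf fin psubset_card_mono[of "C - {f}" A] by auto
    then have b2: "2 \<le> card B" using cardD by linarith
    have a1: "1 \<le> card A" using gA finAB by (metis One_nat_def Suc_leI card_gt_0_iff empty_iff)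
    \<comment> \<open>Adding f to A gains the 1 that the density bound normally loses, at the price
      of counting the ends of f with A.\<close>
    have A_less: "real (card A) < m * (real (card (\<Union>A \<union> f)) - 2)"
    proof -
      have "insert f A \<subset> C" using psub f by blast
      moreover have "f \<notin> A" using AC by blast
      then have ca: "card (insert f A) = card A + 1" using finAB by simp
      ultimately show ?thesis
        using density_copy_less[OF C, of "insert f A"] a1 by (auto simp: Un_commute)
    qed
    have "B \<subset> D" using gA DAB by blast
    then have B_less: "real (card B) - 1 < m * (real (card (\<Union>B)) - 2)"
      using density_copy_less[OF D, of B] b2 by blast
    have AU: "\<Union>A \<union> f \<subseteq> \<Union>C" using AC f by blast
    show ?thesis
    proof (cases "f \<subseteq> \<Union>B")
      case True
      \<comment> \<open>The overlap is exactly the two ends of f, so the strict bounds sum to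
        \<open>card H - 1 < card H - 1\<close>.\<close>
      have "(\<Union>A \<union> f) \<inter> \<Union>B = f" using True interB AU by blast
      moreover have "(\<Union>A \<union> f) \<union> \<Union>B = \<Union>D" using True Un by blast
      ultimately have "card (\<Union>A \<union> f) + card (\<Union>B) = card (\<Union>H) + 2"
        using card_Un_Int[of "\<Union>A \<union> f" "\<Union>B"] finU fin(5) vD card2f by simp
      then have s: "real (card (\<Union>A \<union> f)) + real (card (\<Union>B)) = real (card (\<Union>H)) + 2"
        by linarith
      have "real (card A) + real (card B) - 1
          < m * (real (card (\<Union>A \<union> f)) + real (card (\<Union>B)) - 4)"
        using A_less B_less by (simp add: algebra_simps)
      also have "\<dots> = real (card H) - 1" unfolding s using density_H by simp
      finally show ?thesis using cardD by linarith
    next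
      case False
      \<comment> \<open>With at most one common vertex f is not added to A. The second lost unit is
        outweighed by the additional vertex, which is worth m > 1.\<close>
      have "\<Union>A \<inter> \<Union>B \<subset> f" using False interB AU by blast
      then have "card (\<Union>A \<inter> \<Union>B) < 2" using fin(5) card2f by (metis psubset_card_mono)
      then have s: "real (card (\<Union>A)) + real (card (\<Union>B)) \<le> real (card (\<Union>H)) + 1"
        using card_Un_Int[OF finU] Un vD by simp
      have "real (card A) - 1 \<le> m * (real (card (\<Union>A)) - 2)"
        using density_copy_le[OF D, of A] gA DAB by auto
      then have "real (card A) + real (card B) - 2
          \<le> m * (real (card (\<Union>A)) + real (card (\<Union>B)) - 4)"
        using B_less by (simp add: algebra_simps)
      also have "\<dots> \<le> m * (real (card (\<Union>H)) + 1 - 4)" using s m_gt_1 by simp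
      also have "\<dots> = real (card H) - 1 - m" unfolding density_H by (simp add: algebra_simps)
      finally show ?thesis using cardD m_gt_1 by linarith
    qed
  qed
qed

section \<open>Degrees, triangles and pairwise intersecting edges in a copy\<close>

lemma min_degree:
  assumes C: "C \<in> copies" and x: "x \<in> e" "e \<in> C"
  shows "\<exists>h\<in>C. x \<in> h \<and> h \<noteq> e"
proof (rule ccontr)
  assume none: "\<not> ?thesis"
  define A where "A = C - {e}"
  have fin: "finite (\<Union>C)" "finite C" using C finite_Union_copy finite_copy by auto
  have cA: "card A = card H - 1" using C x fin by (simp add: A_def card_copy)
  \<comment> \<open>If e is the only edge at x, deleting e also deletes x; one edge for one vertex
    is too little when m > 1, and the rest would be too dense.\<close>
  have "\<Union>A \<subseteq> \<Union>C - {x}" using none by (auto simp: A_def)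
  then have "card (\<Union>A) \<le> card (\<Union>C - {x})" using fin by (intro card_mono) auto
  also have "\<dots> = card (\<Union>H) - 1" using x card_Union_copy[OF C] fin
    by (metis Union_iff card_Diff_singleton)
  finally have "real (card (\<Union>A)) \<le> real (card (\<Union>H)) - 1" using v_ge_4 by linarith
  then have "m * (real (card (\<Union>A)) - 2) \<le> m * (real (card (\<Union>H)) - 3)"
    using m_gt_1 by simp
  moreover have "A \<noteq> {}" using cA five_edges by auto
  then have "real (card A) - 1 \<le> m * (real (card (\<Union>A)) - 2)"
    using density_copy_le[OF C, of A] by (auto simp: A_def)
  ultimately show False using cA five_edges density_H m_gt_1 by (simp add: algebra_simps)
qed

text \<open>A triangle has 2-density 2. As a proper part of the copy it forces m > 2, and the
  conclusion is the integer form of \<open>e - 1 > 2 * (v - 2)\<close>.\<close>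

lemma triangle_dense:
  assumes C: "C \<in> copies" and t: "{a,b} \<in> C" "{a,c} \<in> C" "{b,c} \<in> C"
    and d: "a \<noteq> b" "a \<noteq> c" "b \<noteq> c"
  shows "2 * card (\<Union>H) \<le> card H + 2"
proof -
  let ?T = "{{a,b},{a,c},{b,c}}"
  have c3: "card ?T = 3" using d by (simp add: doubleton_eq_iff)
  have "?T \<noteq> C"
  proof
    assume "?T = C"
    then have "card ?T = card H" by (simp only: card_copy[OF C])
    then show False using c3 five_edges by linarith
  qed
  then have "?T \<subset> C" using t by (intro psubsetI) simp_all
  from density_copy_less[OF C this, unfolded c3]
  have "2 < m * (real (card (\<Union>?T)) - 2)" by simp
  moreover have "\<Union>?T = {a,b,c}" by blast
  then have "card (\<Union>?T) = 3" using d by simp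
  ultimately have "2 < m * (real 3 - 2)" by (simp only:)
  then have "2 < m" by simp
  then have "2 * (real (card (\<Union>H)) - 2) < m * (real (card (\<Union>H)) - 2)"
    using v_ge_4 by (intro mult_strict_right_mono) auto
  then have "real (2 * card (\<Union>H)) < real (card H + 3)" using density_H by simp
  then show ?thesis by linarith
qed

lemma intersecting_pairs:
  assumes "\<And>e. e \<in> F \<Longrightarrow> card e = 2" "\<And>e e'. e \<in> F \<Longrightarrow> e' \<in> F \<Longrightarrow> e \<inter> e' \<noteq> {}"
    and "3 \<le> card F"
  obtains (star) x where "\<And>e. e \<in> F \<Longrightarrow> x \<in> e"
  | (triangle) a b c where "a \<noteq> b" "a \<noteq> c" "b \<noteq> c" "F = {{a,b},{a,c},{b,c}}"
proof -
  have "\<exists>e e'. e \<in> F \<and> e' \<in> F \<and> e \<noteq> e'"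
    using assms(3) by (metis One_nat_def card_le_Suc0_iff_eq card.infinite not_numeral_le_zero
        numeral_3_eq_3 Suc_le_mono le_SucI not_less_eq_eq le0)
  then obtain e e' where e: "e \<in> F" "e' \<in> F" "e \<noteq> e'" by blast
  then obtain a where a: "a \<in> e" "a \<in> e'" using assms(2) by blast
  obtain b where b: "e = {a,b}" "b \<noteq> a" using assms(1)[OF e(1)] a by (auto simp: card_2_iff)
  obtain c where c: "e' = {a,c}" "c \<noteq> a" using assms(1)[OF e(2)] a by (auto simp: card_2_iff)
  have bc: "b \<noteq> c" using b c e by auto
  show thesis
  proof (cases "\<forall>h\<in>F. a \<in> h")
    case True then show thesis using star by blast
  next
    case False
    then obtain h where h: "h \<in> F" "a \<notin> h" by blast
    have "b \<in> h" "c \<in> h" using assms(2)[OF h(1) e(1)] assms(2)[OF h(1) e(2)] h b c by auto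
    then have hbc: "h = {b,c}" using assms(1)[OF h(1)] bc by (auto simp: card_2_iff)
    have "k \<in> {{a,b},{a,c},{b,c}}" if k: "k \<in> F" for k
    proof -
      have pair: "k = {p,q}" if "p \<in> k" "q \<in> k" "p \<noteq> q" for p q
        using assms(1)[OF k] that by (auto simp: card_2_iff)
      have "a \<in> k \<or> b \<in> k" "a \<in> k \<or> c \<in> k" "b \<in> k \<or> c \<in> k"
        using assms(2)[OF k e(1)] assms(2)[OF k e(2)] assms(2)[OF k h(1)] b c hbc by simp_all
      then consider "a \<in> k" "b \<in> k" | "a \<in> k" "c \<in> k" | "b \<in> k" "c \<in> k" by blast
      then show ?thesis
        using pair[of a b] pair[of a c] pair[of b c] b(2) c(2) bc by cases simp_all
    qed
    then have "F \<subseteq> {{a,b},{a,c},{b,c}}" by blast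
    moreover have "{{a,b},{a,c},{b,c}} \<subseteq> F" using e h b c hbc by simp
    ultimately have "F = {{a,b},{a,c},{b,c}}" by (rule equalityI)
    with b(2)[symmetric] c(2)[symmetric] bc show thesis by (rule triangle)
  qed
qed

text \<open>Five edges are decisive here: in a 4-cycle two adjacent edges leave only two others. If
  at most two edges lay outside F, then F would have at least three edges and be a triangle or a
  star. Both cases produce a triangle in C, hence at least \<open>2 * v - 2\<close> edges, more than
  F and two further edges supply on \<open>v \<ge> 4\<close> vertices.\<close>

lemma card_nonintersecting_part:
  assumes C: "C \<in> copies" and F: "F \<subseteq> C"
    and int: "\<And>e e'. e \<in> F \<Longrightarrow> e' \<in> F \<Longrightarrow> e \<inter> e' \<noteq> {}"
  shows "3 \<le> card (C - F)"
proof (rule ccontr)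
  assume "\<not> ?thesis"
  then have X: "card (C - F) \<le> 2" by simp
  have finC: "finite C" "finite (\<Union>C)" using C finite_copy finite_Union_copy by auto
  have cF: "card H \<le> card F + 2"
    using X card_Diff_subset[of F C] F finC finite_subset card_copy[OF C] by fastforce
  have F3: "3 \<le> card F" using cF five_edges by linarith
  show False
  proof (rule intersecting_pairs[of F])
    show "card e = 2" if "e \<in> F" for e using that F C card_edge_copy by blast
    show "3 \<le> card F" by fact
    show "e \<inter> e' \<noteq> {}" if "e \<in> F" "e' \<in> F" for e e' using int that by blast
  next
    fix a b c assume abc: "a \<noteq> b" "a \<noteq> c" "b \<noteq> c" "F = {{a,b},{a,c},{b,c}}"
    have "2 * card (\<Union>H) \<le> card H + 2" using triangle_dense[OF C _ _ _ abc(1-3)] F abc(4) by auto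
    moreover have "card F \<le> 3" unfolding abc(4) by (simp add: card_insert_if)
    ultimately show False using cF v_ge_4 by linarith
  next
    fix x assume star: "\<And>e. e \<in> F \<Longrightarrow> x \<in> e"
    have "inj_on (\<lambda>e. e - {x}) F" using star by (auto simp: inj_on_def)
    moreover have "(\<lambda>e. e - {x}) ` F \<subseteq> (\<lambda>y. {y}) ` (\<Union>C - {x})"
    proof
      fix s assume "s \<in> (\<lambda>e. e - {x}) ` F"
      then obtain e where e: "e \<in> F" "s = e - {x}" by blast
      then obtain y where "e = {x,y}" "x \<noteq> y" using star[OF e(1)] card_edge_copy[OF C, of e] F
        by (auto simp: card_2_iff)
      then show "s \<in> (\<lambda>y. {y}) ` (\<Union>C - {x})" using e F by auto
    qed
    ultimately have "card F \<le> card ((\<lambda>y. {y}) ` (\<Union>C - {x}))"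
      using finC by (metis card_image card_mono finite_Diff finite_imageI)
    also have "\<dots> \<le> card (\<Union>C - {x})" using finC by (intro card_image_le) auto
    also have "\<dots> = card (\<Union>H) - 1"
    proof -
      have "F \<noteq> {}" using F3 by auto
      then have "x \<in> \<Union>C" using star F by blast
      then show ?thesis using finC card_Union_copy[OF C] by simp
    qed
    finally have starsize: "card F \<le> card (\<Union>H) - 1" .
    \<comment> \<open>Every leaf of the star has a second edge, which lies outside F. At most two
      such edges serve at least three leaves, so one of them joins two leaves and closes a triangle
      with x.\<close>
    have "\<exists>h. h \<in> C - F \<and> y \<in> h" if xy: "{x,y} \<in> F" "x \<noteq> y" for y
    proof -
      obtain h where h: "h \<in> C" "y \<in> h" "h \<noteq> {x,y}" using min_degree[OF C, of y "{x,y}"] xy F by blast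
      then have "h \<notin> F" using star[of h] xy card_edge_copy[OF C, of h] by (auto simp: card_2_iff)
      then show ?thesis using h by blast
    qed
    then obtain g where g: "\<And>y. {x,y} \<in> F \<Longrightarrow> x \<noteq> y \<Longrightarrow> g y \<in> C - F \<and> y \<in> g y" by metis
    define L where "L = {y. {x,y} \<in> F \<and> x \<noteq> y}"
    have FL: "F = (\<lambda>y. {x,y}) ` L"
    proof
      show "F \<subseteq> (\<lambda>y. {x,y}) ` L"
      proof
        fix e assume e: "e \<in> F"
        then obtain y where "e = {x,y}" "x \<noteq> y" using star[OF e(1)] card_edge_copy[OF C, of e] F
          by (auto simp: card_2_iff)
        then show "e \<in> (\<lambda>y. {x,y}) ` L" using e by (auto simp: L_def)
      qed
    qed (auto simp: L_def)
    have finL: "finite L" using finC F by (intro finite_subset[of L "\<Union>C"]) (auto simp: L_def)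
    then have "card F \<le> card L" unfolding FL by (rule card_image_le)
    then have "card L \<ge> 3" using F3 by linarith
    moreover have "g ` L \<subseteq> C - F" using g by (auto simp: L_def)
    then have "card (g ` L) \<le> 2" using X finC by (meson card_mono finite_Diff le_trans)
    ultimately have "\<not> inj_on g L" using card_image[of g L] by linarith
    then obtain y z where yz: "y \<in> L" "z \<in> L" "g y = g z" "y \<noteq> z" by (auto simp: inj_on_def)
    then have gy: "g y \<in> C" "y \<in> g y" "z \<in> g y" using g[of y] g[of z] by (auto simp: L_def)
    then have "g y = {y,z}" using card_edge_copy[OF C, of "g y"] yz by (auto simp: card_2_iff)
    then have "2 * card (\<Union>H) \<le> card H + 2"
      using triangle_dense[OF C, of x y z] gy yz F by (auto simp: L_def)
    then show False using starsize cF v_ge_4 by linarith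
  qed
qed

subsection \<open>Critical edge sets\<close>

definition proper_on :: "nat set set \<Rightarrow> (nat set \<Rightarrow> nat) \<Rightarrow> bool" where
  "proper_on E col \<longleftrightarrow>
     (\<forall>e\<in>E. \<forall>e'\<in>E. e \<noteq> e' \<and> e \<inter> e' \<noteq> {} \<longrightarrow> col e \<noteq> col e')"

definition rainbow_forced :: "nat set set \<Rightarrow> bool" where
  "rainbow_forced E \<longleftrightarrow>
     (\<forall>col. proper_on E col \<longrightarrow> (\<exists>C\<in>copies. C \<subseteq> E \<and> inj_on col C))"

definition critical :: "nat set set \<Rightarrow> bool" where
  "critical E \<longleftrightarrow> finite E \<and> rainbow_forced E \<and> (\<forall>E'. E' \<subset> E \<longrightarrow> \<not> rainbow_forced E')"

definition shared :: "nat set set \<Rightarrow> nat set set \<Rightarrow> nat set set" where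
  "shared E C = {g \<in> C. \<exists>D\<in>copies. D \<subseteq> E \<and> D \<noteq> C \<and> g \<in> D}"

lemma critical_subset:
  assumes "finite E" "rainbow_forced E"
  obtains E' where "E' \<subseteq> E" "critical E'"
proof -
  have "\<exists>E'\<subseteq>E. critical E'"
    using assms
  proof (induction E rule: finite_psubset_induct)
    case (psubset E)
    show ?case
    proof (cases "\<exists>E'. E' \<subset> E \<and> rainbow_forced E'")
      case True
      then show ?thesis using psubset by (meson order_trans psubset_imp_subset)
    next
      case False
      then show ?thesis using psubset by (auto simp: critical_def)
    qed
  qed
  then show thesis using that by blast
qed

lemma copy_nonempty: "C \<in> copies \<Longrightarrow> C \<noteq> {}"
  using card_copy five_edges by fastforce

lemma rainbow_forced_has_copy:
  assumes "finite E" "rainbow_forced E"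
  shows "\<exists>C\<in>copies. C \<subseteq> E"
proof -
  obtain col :: "nat set \<Rightarrow> nat" where "inj_on col E"
    using finite_imp_inj_to_nat_seg[OF assms(1)] by blast
  then have "proper_on E col" by (auto simp: proper_on_def inj_on_def)
  then show ?thesis using assms(2) by (auto simp: rainbow_forced_def)
qed

text \<open>Two disjoint edges that lie in no other copy could be recoloured with a common fresh
  colour, so the unshared edges of a copy pairwise intersect.\<close>

lemma card_shared_critical:
  assumes crit: "critical E" and C: "C \<in> copies" "C \<subseteq> E"
  shows "3 \<le> card (shared E C)"
proof -
  define F where "F = C - shared E C"
  have only: "D = C" if "D \<in> copies" "D \<subseteq> E" "g \<in> D" "g \<in> F" for D g
    using that by (auto simp: F_def shared_def)
  have "e \<inter> e' \<noteq> {}" if e: "e \<in> F" "e' \<in> F" for e e'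
  proof
    assume disj: "e \<inter> e' = {}"
    have eC: "e \<in> C" "e' \<in> C" using e by (auto simp: F_def)
    then have ne: "e \<noteq> e'" using disj card_edge_copy[OF C(1) eC(1)] by auto
    \<comment> \<open>Minimality yields a colouring without rainbow copies after both edges are
      removed. Once they are recoloured, a copy using either of them is C, which repeats the fresh
      colour, and any other copy is as before.\<close>
    have "E - {e, e'} \<subset> E" using eC C by blast
    then have "\<not> rainbow_forced (E - {e, e'})" using crit by (simp add: critical_def)
    then obtain col where col: "proper_on (E - {e,e'}) col"
      "\<And>D. D \<in> copies \<Longrightarrow> D \<subseteq> E - {e,e'} \<Longrightarrow> \<not> inj_on col D"
      by (auto simp: rainbow_forced_def)
    have "finite (col ` E)" using crit by (simp add: critical_def)
    then obtain N where "N \<notin> col ` E" using ex_new_if_finite[OF infinite_UNIV_nat] by metis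
    then have N: "col g \<noteq> N" if "g \<in> E" for g using that by blast
    define col' where "col' = (\<lambda>g. if g = e \<or> g = e' then N else col g)"
    have "proper_on E col'"
      unfolding proper_on_def
    proof (intro ballI impI)
      fix a b assume ab: "a \<in> E" "b \<in> E" "a \<noteq> b \<and> a \<inter> b \<noteq> {}"
      show "col' a \<noteq> col' b"
      proof (cases "a \<in> {e, e'} \<or> b \<in> {e, e'}")
        case True
        then show ?thesis
          using N[OF ab(1)] N[OF ab(2)] ab(3) disj by (auto simp: col'_def Int_commute)
      next
        case False
        then show ?thesis using col(1) ab by (simp add: col'_def proper_on_def)
      qed
    qed
    then obtain D where D: "D \<in> copies" "D \<subseteq> E" "inj_on col' D"
      using crit by (auto simp: critical_def rainbow_forced_def)
    show False
    proof (cases "e \<in> D \<or> e' \<in> D")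
      case True
      then have "D = C" using only D(1,2) e by blast
      then have "e \<in> D" "e' \<in> D" using eC by auto
      moreover have "col' e = col' e'" by (simp add: col'_def)
      ultimately show False using D(3) ne by (auto dest: inj_onD)
    next
      case False
      then have "col' g = col g" if "g \<in> D" for g using that by (auto simp: col'_def)
      then have "inj_on col D" using D(3) by (simp add: inj_on_def)
      moreover have "D \<subseteq> E - {e,e'}" using False D(2) by blast
      ultimately show False using col(2) D(1) by blast
    qed
  qed
  moreover have "F \<subseteq> C" by (auto simp: F_def)
  ultimately have "3 \<le> card (C - F)" using card_nonintersecting_part[OF C(1)] by blast
  moreover have "C - F = shared E C" by (auto simp: F_def shared_def)
  ultimately show ?thesis by simp
qed

text \<open>By minimality both S and its complement have proper colourings without rainbow copies.
  Even colours on S and odd ones elsewhere combine them into a proper colouring of E, so some copy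
  must cross.\<close>

lemma critical_connected:
  assumes crit: "critical E" and S: "S \<subset> E" "S \<noteq> {}"
  shows "\<exists>D\<in>copies. D \<subseteq> E \<and> \<not> D \<subseteq> S \<and> D \<inter> S \<noteq> {}"
proof (rule ccontr)
  assume neg: "\<not> ?thesis"
  have "\<not> rainbow_forced S" using crit S by (simp add: critical_def)
  then obtain c1 where c1: "proper_on S c1" "\<And>D. D \<in> copies \<Longrightarrow> D \<subseteq> S \<Longrightarrow> \<not> inj_on c1 D"
    by (auto simp: rainbow_forced_def)
  have "E - S \<subset> E" using S by blast
  then have "\<not> rainbow_forced (E - S)" using crit by (simp add: critical_def)
  then obtain c2 where c2: "proper_on (E - S) c2"
    "\<And>D. D \<in> copies \<Longrightarrow> D \<subseteq> E - S \<Longrightarrow> \<not> inj_on c2 D"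
    by (auto simp: rainbow_forced_def)
  define col where "col = (\<lambda>e. if e \<in> S then 2 * c1 e else Suc (2 * c2 e))"
  have par: "2 * a \<noteq> Suc (2 * b)" "Suc (2 * b) \<noteq> 2 * a" for a b :: nat by presburger+
  have "proper_on E col"
    unfolding proper_on_def
  proof (intro ballI impI)
    fix a b assume ab: "a \<in> E" "b \<in> E" "a \<noteq> b \<and> a \<inter> b \<noteq> {}"
    consider "a \<in> S" "b \<in> S" | "a \<notin> S" "b \<notin> S" | "(a \<in> S) \<noteq> (b \<in> S)" by blast
    then show "col a \<noteq> col b"
      using c1(1) c2(1) par ab by cases (simp_all add: col_def proper_on_def)
  qed
  then obtain D where D: "D \<in> copies" "D \<subseteq> E" "inj_on col D"
    using crit by (auto simp: critical_def rainbow_forced_def)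
  then consider "D \<subseteq> S" | "D \<inter> S = {}" using neg by blast
  then show False
  proof cases
    case 1
    then have "col e = 2 * c1 e" if "e \<in> D" for e using that by (auto simp: col_def)
    then have "inj_on c1 D" using D(3) by (simp add: inj_on_def)
    then show False using c1(2) D(1) 1 by blast
  next
    case 2
    then have "col e = Suc (2 * c2 e)" if "e \<in> D" for e using that by (auto simp: col_def)
    then have "inj_on c2 D" using D(3) by (simp add: inj_on_def)
    moreover have "D \<subseteq> E - S" using 2 D(2) by blast
    ultimately show False using c2(2) D(1) by blast
  qed
qed

subsection \<open>The exploration\<close>

text \<open>The classification is by common vertices, not edges: one common edge together with a
  further common vertex already saves a power of n and counts as degenerate. Every copy that shares
  an edge with S but leaves S is of one of the two kinds
  (\<open>regular_or_degenerate\<close>).\<close>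

definition regular :: "nat set set \<Rightarrow> nat set \<Rightarrow> nat set set set" where
  "regular S g = {D \<in> copies. g \<in> D \<and> \<Union>D \<inter> \<Union>S = g}"

definition degenerate :: "nat set set \<Rightarrow> nat set set set" where
  "degenerate S = {D \<in> copies. D \<inter> S \<noteq> {} \<and> \<not> D \<subseteq> S \<and> 2 < card (\<Union>D \<inter> \<Union>S)}"

text \<open>The edge f stays in the remainder, so a lone copy is glued along any of its edges; hence
  the exploration starts with a live copy.\<close>

definition glued :: "nat set set \<Rightarrow> nat set set \<Rightarrow> nat set \<Rightarrow> bool" where
  "glued S C f \<longleftrightarrow> C \<in> copies \<and> C \<subseteq> S \<and> f \<in> C \<and> \<Union>C \<inter> \<Union>(S - (C - {f})) \<subseteq> f"

text \<open>\<open>C\<close> is attached to the rest of \<open>S\<close> along \<open>f\<close> only, so by \<open>glue_unique\<close> no other copy in \<open>S\<close>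
  uses an edge of \<open>C\<close> besides \<open>f\<close>: the shared edges of \<open>C\<close> still have to be explored.\<close>

definition live :: "nat set set \<Rightarrow> nat set set set" where
  "live S = {C. \<exists>f. glued S C f}"

definition pick :: "nat set set \<Rightarrow> nat set set" where
  "pick S = (SOME C. C \<in> live S)"

text \<open>The live copy to be processed is a function of the explored set. Only this keeps the number of
  choices per round bounded; a free choice of the attaching edge, affordable only boundedly often,
  occurs when no live copy is left.\<close>

definition up :: "nat set set \<Rightarrow> nat set set set" where
  "up S = (if live S = {} then {S \<union> D |D g. g \<in> S \<and> D \<in> regular S g}
     else {S \<union> D1 \<union> D2 |D1 D2 g1 g2. g1 \<in> pick S \<and> g2 \<in> pick S \<and>
             D1 \<in> regular S g1 \<and> D2 \<in> regular (S \<union> D1) g2})"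

text \<open>A degenerate first copy ends the round at once; the second form is a round whose first
  attachment was still regular.\<close>

definition down :: "nat set set \<Rightarrow> nat set set set" where
  "down S = {S \<union> D |D. D \<in> degenerate S} \<union>
     {S \<union> D1 \<union> D2 |D1 D2 g1. live S \<noteq> {} \<and> g1 \<in> pick S \<and>
        D1 \<in> regular S g1 \<and> D2 \<in> degenerate (S \<union> D1)}"

text \<open>In \<open>reach r d S\<close>, \<open>r\<close> counts the regular rounds and \<open>d\<close> the degenerate ones.\<close>

inductive reach :: "nat \<Rightarrow> nat \<Rightarrow> nat set set \<Rightarrow> bool" where
  start: "C \<in> copies \<Longrightarrow> reach 0 0 C"
| up: "reach r d S \<Longrightarrow> S' \<in> up S \<Longrightarrow> reach (Suc r) d S'"
| down: "reach r d S \<Longrightarrow> S' \<in> down S \<Longrightarrow> reach r (Suc d) S'"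

section \<open>How live copies behave under attachment\<close>

lemma gluedD:
  assumes "glued S C f"
  shows "C \<in> copies" "C \<subseteq> S" "f \<in> C" "\<Union>C \<inter> \<Union>(S - (C - {f})) \<subseteq> f"
  using assms by (auto simp: glued_def)

lemma glued_unique:
  assumes "glued S C f" "D \<in> copies" "D \<subseteq> S" "g \<in> D" "g \<in> C" "g \<noteq> f"
  shows "D = C"
proof -
  note G = gluedD[OF assms(1)]
  have "D \<subseteq> (S - (C - {f})) \<union> C" using assms(3) by blast
  then show ?thesis using glue_unique[OF G(1) assms(2) G(3,4)] assms by blast
qed

lemma glued_disjoint:
  assumes "glued S C f" "D \<in> copies" "D \<subseteq> S" "D \<noteq> C"
  shows "\<Union>C \<inter> \<Union>D \<subseteq> f"
proof -
  have "D \<subseteq> S - (C - {f})" using glued_unique[OF assms(1-3)] assms by blast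
  then show ?thesis using gluedD(4)[OF assms(1)] by blast
qed

lemma glued_extend:
  assumes "glued S C f" "\<Union>C \<inter> \<Union>D \<subseteq> f"
  shows "glued (S \<union> D) C f"
proof -
  have "\<Union>C \<inter> \<Union>(S \<union> D - (C - {f})) \<subseteq> (\<Union>C \<inter> \<Union>(S - (C - {f}))) \<union> (\<Union>C \<inter> \<Union>D)" by blast
  also have "\<dots> \<subseteq> f" using gluedD(4)[OF assms(1)] assms(2) by simp
  finally show ?thesis using gluedD(1-3)[OF assms(1)] by (simp add: glued_def le_supI1)
qed

lemma live_copy: "C \<in> live S \<Longrightarrow> C \<in> copies \<and> C \<subseteq> S"
  by (auto simp: live_def dest: gluedD)

lemma finite_live: "finite S \<Longrightarrow> finite (live S)"
  using live_copy by (intro finite_subset[of "live S" "Pow S"]) auto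

lemma pick_live: "live S \<noteq> {} \<Longrightarrow> pick S \<in> live S"
  by (simp add: pick_def some_in_eq)

lemma regular_copy: "D \<in> regular S g \<Longrightarrow> D \<in> copies"
  and degenerate_copy: "D \<in> degenerate S \<Longrightarrow> D \<in> copies"
  by (simp_all add: regular_def degenerate_def)

lemma regular_not_subset:
  assumes "D \<in> regular S g"
  shows "\<not> D \<subseteq> S"
proof
  assume "D \<subseteq> S"
  then have "\<Union>D \<inter> \<Union>S = \<Union>D" by blast
  then have "D \<in> copies" "\<Union>D \<in> D" using assms by (simp_all add: regular_def)
  then have "card (\<Union>D) = 2" using card_edge_copy by blast
  then show False using card_Union_copy[OF \<open>D \<in> copies\<close>] v_ge_4 by simp
qed

lemma regular_live:
  assumes "D \<in> regular S g" "g \<in> S"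
  shows "D \<in> live (S \<union> D)"
proof -
  have D: "D \<in> copies" "g \<in> D" "\<Union>D \<inter> \<Union>S = g" using assms(1) by (simp_all add: regular_def)
  have "S \<union> D - (D - {g}) \<subseteq> S" using assms(2) by blast
  then have "\<Union>D \<inter> \<Union>(S \<union> D - (D - {g})) \<subseteq> g" using D(3) by blast
  then have "glued (S \<union> D) D g" using D by (simp add: glued_def)
  then show ?thesis by (auto simp: live_def)
qed

text \<open>D meets S only in g, which lies in C, and any other live copy meets C only within its
  own attaching edge. So C alone can cease to be live.\<close>

lemma regular_live_old:
  assumes D: "D \<in> regular S g" and C: "C \<in> copies" "C \<subseteq> S" "g \<in> C"
  shows "live S - {C} \<subseteq> live (S \<union> D)"
proof
  fix B assume B: "B \<in> live S - {C}"
  then obtain f where f: "glued S B f" by (auto simp: live_def)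
  have "\<Union>B \<subseteq> \<Union>S" using gluedD(2)[OF f] by blast
  moreover have "\<Union>D \<inter> \<Union>S = g" using D by (simp add: regular_def)
  ultimately have "\<Union>B \<inter> \<Union>D \<subseteq> \<Union>B \<inter> \<Union>C" using C(3) by blast
  also have "\<dots> \<subseteq> f" using glued_disjoint[OF f C(1,2)] B by blast
  finally show "B \<in> live (S \<union> D)" using glued_extend[OF f] by (auto simp: live_def)
qed

text \<open>C may be lost but D is gained: a single attachment only breaks even, which is why a
  regular round makes two of them at the same live copy.\<close>

lemma card_live_regular:
  assumes "finite S" "D \<in> regular S g" "C \<in> copies" "C \<subseteq> S" "g \<in> C"
  shows "card (live S) \<le> card (live (S \<union> D))"
proof -
  have D: "D \<in> live (S \<union> D)" "D \<notin> live S"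
    using regular_live[OF assms(2)] assms regular_not_subset[OF assms(2)] live_copy by auto
  have fin: "finite (live S)" "finite (live (S \<union> D))"
    using assms finite_live finite_copy[OF regular_copy[OF assms(2)]] by auto
  have "card (live S) \<le> card (insert D (live S - {C}))"
    using fin D by (simp add: card_Diff_singleton_if) linarith
  also have "\<dots> \<le> card (live (S \<union> D))"
    using regular_live_old[OF assms(2-5)] D fin by (intro card_mono) auto
  finally show ?thesis .
qed

text \<open>Every destroyed live copy contributes a private vertex of \<open>D\<close>.\<close>

lemma card_live_any:
  assumes fin: "finite S" and D: "D \<in> copies"
  shows "card (live S) \<le> card (live (S \<union> D)) + card (\<Union>H)"
proof -
  define L where "L = live S - live (S \<union> D)"
  have "\<exists>f x. glued S B f \<and> x \<in> \<Union>D \<and> x \<in> \<Union>B \<and> x \<notin> f" if "B \<in> L" for B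
  proof -
    obtain f where f: "glued S B f" using \<open>B \<in> L\<close> by (auto simp: L_def live_def)
    have "\<not> \<Union>B \<inter> \<Union>D \<subseteq> f" using glued_extend[OF f] \<open>B \<in> L\<close> by (auto simp: L_def live_def)
    then show ?thesis using f by blast
  qed
  then obtain f x where fx: "\<And>B. B \<in> L \<Longrightarrow> glued S B (f B) \<and> x B \<in> \<Union>D \<and> x B \<in> \<Union>B \<and> x B \<notin> f B"
    by metis
  have "inj_on x L"
  proof (rule inj_onI, rule ccontr)
    fix B B' assume B: "B \<in> L" "B' \<in> L" "x B = x B'" "B \<noteq> B'"
    have "\<Union>B \<inter> \<Union>B' \<subseteq> f B"
      using glued_disjoint[of S B "f B" B'] fx[OF B(1)] fx[OF B(2)] gluedD[of S B' "f B'"] B(4) by blast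
    then show False using fx[OF B(1)] fx[OF B(2)] B(3) by (metis IntI subsetD)
  qed
  moreover have "x ` L \<subseteq> \<Union>D" using fx by blast
  ultimately have "card L \<le> card (\<Union>D)"
    using card_inj_on_le finite_Union_copy[OF D] by blast
  then have L: "card L \<le> card (\<Union>H)" using card_Union_copy[OF D] by simp
  have "live S \<subseteq> L \<union> live (S \<union> D)" by (auto simp: L_def)
  moreover have finL: "finite (live S)" "finite (live (S \<union> D))"
    using fin D finite_copy finite_live by auto
  ultimately have "card (live S) \<le> card (L \<union> live (S \<union> D))"
    by (intro card_mono) (auto simp: L_def)
  also have "\<dots> \<le> card L + card (live (S \<union> D))" by (rule card_Un_le)
  finally show ?thesis using L by linarith
qed

text \<open>Both attachments are made at the picked copy, so that copy is the only possible loss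
  against two gains. Without any live copy the single attachment provides the first one.\<close>

lemma card_live_up:
  assumes fin: "finite S" and S': "S' \<in> up S"
  shows "Suc (card (live S)) \<le> card (live S')"
proof (cases "live S = {}")
  case True
  then obtain D g where D: "S' = S \<union> D" "g \<in> S" "D \<in> regular S g"
    using S' by (auto simp: up_def)
  then have "D \<in> live S'" using regular_live by blast
  moreover have "finite (live S')" using D fin finite_live finite_copy regular_copy by auto
  ultimately show ?thesis using True by (auto simp: Suc_le_eq card_gt_0_iff)
next
  case False
  define C where "C = pick S"
  obtain D1 D2 g1 g2 where D: "S' = S \<union> D1 \<union> D2" "g1 \<in> C" "g2 \<in> C"
    "D1 \<in> regular S g1" "D2 \<in> regular (S \<union> D1) g2"
    using S' False unfolding C_def by (auto simp: up_def)
  have C: "C \<in> copies" "C \<subseteq> S" "C \<in> live S" using pick_live[OF False] live_copy by (auto simp: C_def)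
  have not: "\<not> D1 \<subseteq> S" "\<not> D2 \<subseteq> S \<union> D1" using D regular_not_subset by auto
  have fin': "finite (live S)" "finite (live S')"
    using D fin finite_live finite_copy regular_copy by auto
  have "D1 \<in> live (S \<union> D1)" using regular_live[OF D(4)] C D by blast
  moreover have C1: "D1 \<noteq> C" using not C by blast
  ultimately have D1: "D1 \<in> live S'"
    using regular_live_old[OF D(5) C(1)] C D by blast
  have D2: "D2 \<in> live S'" using regular_live[OF D(5)] C D by blast
  have old: "live S - {C} \<subseteq> live S'"
    using regular_live_old[OF D(4) C(1)] regular_live_old[OF D(5) C(1)] C D by blast
  have nin: "D1 \<notin> live S" "D2 \<notin> live S" "D1 \<noteq> D2" using not live_copy by blast+
  have "0 < card (live S)" using fin' C(3) by (auto simp: card_gt_0_iff)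
  then have "Suc (card (live S)) = card (insert D1 (insert D2 (live S - {C})))"
    using nin fin' C(3) by (simp add: card_Diff_singleton_if)
  also have "\<dots> \<le> card (live S')" using fin' D1 D2 old by (intro card_mono) auto
  finally show ?thesis .
qed

text \<open>A preceding regular attachment does not reduce the number of live copies, so the loss is
  that of the degenerate copy alone.\<close>

lemma card_live_down:
  assumes fin: "finite S" and S': "S' \<in> down S"
  shows "card (live S) \<le> card (live S') + card (\<Union>H)"
proof -
  consider D where "S' = S \<union> D" "D \<in> degenerate S"
    | D1 D2 g1 where "S' = S \<union> D1 \<union> D2" "live S \<noteq> {}" "g1 \<in> pick S" "D1 \<in> regular S g1"
      "D2 \<in> degenerate (S \<union> D1)"
    using S' unfolding down_def by blast
  then show ?thesis
  proof cases
    case 1 then show ?thesis using card_live_any[OF fin] degenerate_copy by blast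
  next
    case 2
    have "card (live S) \<le> card (live (S \<union> D1))"
      using card_live_regular[OF fin 2(4)] live_copy[OF pick_live[OF 2(2)]] 2(3) by blast
    also have "\<dots> \<le> card (live (S \<union> D1 \<union> D2)) + card (\<Union>H)"
      using 2 fin by (intro card_live_any) (auto intro: degenerate_copy finite_copy regular_copy)
    finally show ?thesis using 2(1) by simp
  qed
qed

section \<open>Size and live-copy balance of reachable sets\<close>

lemma step_cases:
  assumes "S' \<in> up S \<or> S' \<in> down S"
  obtains D1 D2 where "D1 \<in> copies" "D2 \<in> copies" "S' = S \<union> D1 \<union> D2"
proof -
  consider D where "D \<in> copies" "S' = S \<union> D" 
    | D1 D2 where "D1 \<in> copies" "D2 \<in> copies" "S' = S \<union> D1 \<union> D2"
    using assms unfolding up_def down_def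
    by (auto split: if_splits dest: regular_copy degenerate_copy)
  then show thesis
  proof cases
    case 1
    \<comment> \<open>A round that adds one copy is treated as adding it twice, so that one size
      bound serves all rounds.\<close>
    then show thesis using that[of D D] by blast
  qed (use that in blast)
qed

lemma live_self: "C \<in> copies \<Longrightarrow> C \<in> live C"
proof -
  assume C: "C \<in> copies"
  then obtain f where "f \<in> C" using copy_nonempty by blast
  then show ?thesis using C by (auto simp: live_def glued_def)
qed

lemma reach_step_bounds:
  assumes "S' = S \<union> D1 \<union> D2" "D1 \<in> copies" "D2 \<in> copies" "finite S"
    and "card S \<le> card H * k" "card (\<Union>S) \<le> card (\<Union>H) * k"
  shows "card S' \<le> card H * (k + 2)" "card (\<Union>S') \<le> card (\<Union>H) * (k + 2)"
proof -
  have "card S' \<le> card S + card D1 + card D2"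
    unfolding assms(1) using card_Un_le[of "S \<union> D1" D2] card_Un_le[of S D1] by simp
  then show "card S' \<le> card H * (k + 2)"
    using assms card_copy[of D1] card_copy[of D2] by (simp add: algebra_simps)
  have "\<Union>S' = \<Union>S \<union> \<Union>D1 \<union> \<Union>D2" using assms(1) by blast
  then have "card (\<Union>S') \<le> card (\<Union>S) + card (\<Union>D1) + card (\<Union>D2)"
    using card_Un_le[of "\<Union>S \<union> \<Union>D1" "\<Union>D2"] card_Un_le[of "\<Union>S" "\<Union>D1"] by simp
  then show "card (\<Union>S') \<le> card (\<Union>H) * (k + 2)"
    using assms card_Union_copy[of D1] card_Union_copy[of D2] by (simp add: algebra_simps)
qed

text \<open>The last conjunct is the balance: it starts with 1 for the live first copy, and it
  bounds r by a multiple of d as soon as no copy is live.\<close>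

lemma reach_bounds:
  "reach r d S \<Longrightarrow> finite S \<and> S \<noteq> {} \<and> (\<forall>e\<in>S. card e = 2) \<and>
     card S \<le> card H * (1 + 2 * (r + d)) \<and> card (\<Union>S) \<le> card (\<Union>H) * (1 + 2 * (r + d)) \<and>
     Suc r \<le> card (live S) + d * card (\<Union>H)"
proof (induction rule: reach.induct)
  case (start C)
  then have "live C \<noteq> {}" "finite (live C)" using live_self finite_live finite_copy by auto
  then show ?case
    using start finite_copy copy_nonempty card_edge_copy
    by (auto simp: card_copy card_Union_copy Suc_le_eq card_gt_0_iff)
next
  case (up r d S S')
  then obtain D1 D2 where D: "D1 \<in> copies" "D2 \<in> copies" "S' = S \<union> D1 \<union> D2" by (metis step_cases)
  have "card (live S) + 1 \<le> card (live S')" using card_live_up up by auto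
  then show ?case
    using reach_step_bounds[OF D(3,1,2), of "1 + 2 * (r + d)"] up D finite_copy card_edge_copy
    by (auto simp: algebra_simps)
next
  case (down r d S S')
  then obtain D1 D2 where D: "D1 \<in> copies" "D2 \<in> copies" "S' = S \<union> D1 \<union> D2" by (metis step_cases)
  have "card (live S) \<le> card (live S') + card (\<Union>H)" using card_live_down down by auto
  then show ?case
    using reach_step_bounds[OF D(3,1,2), of "1 + 2 * (r + d)"] down D finite_copy card_edge_copy
    by (auto simp: algebra_simps)
qed

section \<open>Exploring a critical set until it stops\<close>

lemma regular_or_degenerate:
  assumes "D \<in> copies" "g \<in> D" "g \<in> S" "\<not> D \<subseteq> S"
  shows "D \<in> degenerate S \<or> D \<in> regular S g"
proof (cases "2 < card (\<Union>D \<inter> \<Union>S)")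
  case True
  then show ?thesis using assms by (auto simp: degenerate_def)
next
  case False
  have "finite (\<Union>D \<inter> \<Union>S)" using finite_Union_copy[OF assms(1)] by blast
  moreover have "g \<subseteq> \<Union>D \<inter> \<Union>S" using assms by blast
  moreover have "card g = 2" using assms card_edge_copy by blast
  ultimately have "g = \<Union>D \<inter> \<Union>S" using False by (intro card_seteq) auto
  then show ?thesis using assms by (auto simp: regular_def)
qed

text \<open>Of at least three shared edges of a live copy, two differ from its attaching edge.
  Copies through these other than the live one cannot lie in S by \<open>glued_unique\<close>, so
  they continue the exploration. Without a live copy, connectedness of E supplies the next
  copy.\<close>

lemma progress:
  assumes crit: "critical E" and S: "S \<subseteq> E" "S \<noteq> {}" and more: "live S \<noteq> {} \<or> S \<noteq> E"
  shows "\<exists>S'\<subseteq>E. S' \<in> up S \<or> S' \<in> down S"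
proof (cases "live S = {}")
  case True
  then obtain D g where D: "D \<in> copies" "D \<subseteq> E" "\<not> D \<subseteq> S" "g \<in> D" "g \<in> S"
    using critical_connected[OF crit, of S] S more by blast
  then have "S \<union> D \<subseteq> E" using S by blast
  moreover have "S \<union> D \<in> up S \<or> S \<union> D \<in> down S"
    using regular_or_degenerate[of D g S] D True by (auto simp: up_def down_def)
  ultimately show ?thesis by blast
next
  case False
  define C where "C = pick S"
  obtain f where f: "glued S C f" using pick_live[OF False] by (auto simp: C_def live_def)
  note G = gluedD[OF f]
  have "3 \<le> card (shared E C)" using card_shared_critical[OF crit G(1)] G S by blast
  moreover have "card (shared E C) \<le> Suc (card (shared E C - {f}))"
    by (simp add: card_Diff_singleton_if) linarith
  ultimately have "1 < card (shared E C - {f})" by linarith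
  then have "2 \<le> card (shared E C - {f})" by linarith
  then obtain P where P: "P \<subseteq> shared E C - {f}" "card P = 2"
    using obtain_subset_with_card_n by metis
  then obtain g1 g2 where "P = {g1, g2}" "g1 \<noteq> g2" by (auto simp: card_2_iff)
  then have g: "g1 \<in> shared E C" "g2 \<in> shared E C" "g1 \<noteq> f" "g2 \<noteq> f" "g1 \<noteq> g2"
    using P(1) by auto
  then have gC: "g1 \<in> C" "g2 \<in> C" by (auto simp: shared_def)
  obtain D1 where D1: "D1 \<in> copies" "D1 \<subseteq> E" "D1 \<noteq> C" "g1 \<in> D1" using g by (auto simp: shared_def)
  obtain D2 where D2: "D2 \<in> copies" "D2 \<subseteq> E" "D2 \<noteq> C" "g2 \<in> D2" using g by (auto simp: shared_def)
  have n1: "\<not> D1 \<subseteq> S" using glued_unique[OF f D1(1) _ D1(4)] gC g D1 by blast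
  have n2': "\<not> D2 \<subseteq> S" using glued_unique[OF f D2(1) _ D2(4)] gC g D2 by blast
  have E: "S \<union> D1 \<subseteq> E" "S \<union> D1 \<union> D2 \<subseteq> E" using S D1 D2 by auto
  have gS: "g1 \<in> S" "g2 \<in> S" using gC G by auto
  show ?thesis
  proof (cases "D1 \<in> degenerate S")
    case True
    then have "S \<union> D1 \<in> down S" by (auto simp: down_def)
    then show ?thesis using E by blast
  next
    case False
    then have r1: "D1 \<in> regular S g1" using regular_or_degenerate D1 gS n1 by blast
    \<comment> \<open>If D2 brought nothing new after D1, it would use a new edge of D1 and so equal
      D1 by \<open>glue_unique\<close>. Then g2 would lie in g1, the common part of D1 and
      S.\<close>
    have n2: "\<not> D2 \<subseteq> S \<union> D1"
    proof
      assume sub: "D2 \<subseteq> S \<union> D1"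
      then obtain h where h: "h \<in> D2" "h \<in> D1" "h \<notin> S" using n2' by blast
      have "\<Union>D1 \<inter> \<Union>S \<subseteq> g1" using r1 by (auto simp: regular_def)
      then have "D2 = D1" using glue_unique[OF D1(1) D2(1) D1(4) _ sub, of h] h gS by blast
      then have "g2 \<subseteq> g1" using D2(4) gS r1 by (auto simp: regular_def)
      moreover have "card g1 = 2" "card g2 = 2" using gC G card_edge_copy by auto
      ultimately show False using g(5) by (metis card.infinite card_subset_eq zero_neq_numeral)
    qed
    have "g2 \<in> S \<union> D1" using gS by blast
    then consider "D2 \<in> degenerate (S \<union> D1)" | "D2 \<in> regular (S \<union> D1) g2"
      using regular_or_degenerate[OF D2(1,4) _ n2] by blast
    then have "S \<union> D1 \<union> D2 \<in> up S \<or> S \<union> D1 \<union> D2 \<in> down S"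
    proof cases
      case 1
      then have "S \<union> D1 \<union> D2 \<in> down S"
        unfolding down_def using r1 gC \<open>live S \<noteq> {}\<close> C_def by blast
      then show ?thesis ..
    next
      case 2
      have "S \<union> D1 \<union> D2 \<in> {S \<union> D1 \<union> D2 |D1 D2 g1 g2. g1 \<in> pick S \<and> g2 \<in> pick S \<and>
             D1 \<in> regular S g1 \<and> D2 \<in> regular (S \<union> D1) g2}"
        using r1 2 gC C_def by blast
      then show ?thesis using \<open>live S \<noteq> {}\<close> by (simp add: up_def)
    qed
    then show ?thesis using E by blast
  qed
qed

text \<open>By \<open>progress\<close> the exploration stops before reaching a limit only at E
  itself, with no live copy left. The balance then turns \<open>d < K\<close> into a bound on r, and
  with it on the number of vertices of E.\<close>

lemma exploration_outcome:
  assumes crit: "critical E" and "0 < R" "0 < K"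
  obtains (many_down) r S where "r \<le> R" "reach r K S" "S \<subseteq> E"
  | (many_up) d S where "d < K" "reach R d S" "S \<subseteq> E"
  | (small) "card (\<Union>E) \<le> card (\<Union>H) * (1 + 2 * (K * card (\<Union>H) + K))"
proof -
  let ?stuck = "\<exists>r d. d < K \<and> reach r d E \<and> live E = {}"
  have run: "(\<exists>r\<le>R. \<exists>S\<subseteq>E. reach r K S) \<or> (\<exists>d<K. \<exists>S\<subseteq>E. reach R d S) \<or> ?stuck"
    if "reach r d S" "S \<subseteq> E" "r < R" "d < K" for r d S
    using that
  proof (induction "R + K - (r + d)" arbitrary: r d S rule: less_induct)
    case less
    show ?case
    proof (cases "live S = {} \<and> S = E")
      case True
      then show ?thesis using less.prems(1,4) by blast
    next
      case False
      then obtain S' where S': "S' \<subseteq> E" "S' \<in> up S \<or> S' \<in> down S"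
        using progress[OF crit less.prems(2)] reach_bounds[OF less.prems(1)] by blast
      from S'(2) show ?thesis
      proof
        assume "S' \<in> up S"
        with less.prems(1) have *: "reach (Suc r) d S'" by (rule reach.up)
        show ?thesis
        proof (cases "Suc r = R")
          case True
          then have "reach R d S'" using * by simp
          then show ?thesis using less.prems(4) S'(1) by blast
        next
          case False
          show ?thesis
            by (rule less.hyps[OF _ * S'(1)]) (use False less.prems(3,4) in linarith)+
        qed
      next
        assume "S' \<in> down S"
        with less.prems(1) have *: "reach r (Suc d) S'" by (rule reach.down)
        show ?thesis
        proof (cases "Suc d = K")
          case True
          then have "reach r K S'" using * by simp
          moreover have "r \<le> R" using less.prems(3) by simp
          ultimately show ?thesis using S'(1) by blast
        next
          case False
          show ?thesis
            by (rule less.hyps[OF _ * S'(1)]) (use False less.prems(3,4) in linarith)+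
        qed
      qed
    qed
  qed
  have "\<exists>C\<in>copies. C \<subseteq> E" using crit rainbow_forced_has_copy[of E] by (simp add: critical_def)
  then obtain C where "C \<in> copies" "C \<subseteq> E" ..
  then have "reach 0 0 C" by (simp add: reach.start)
  from run[OF this \<open>C \<subseteq> E\<close> assms(2,3)] show thesis
  proof (elim disjE)
    assume "\<exists>r\<le>R. \<exists>S\<subseteq>E. reach r K S"
    then show thesis using many_down by blast
  next
    assume "\<exists>d<K. \<exists>S\<subseteq>E. reach R d S"
    then show thesis using many_up by blast
  next
    assume ?stuck
    then obtain r d where *: "d < K" "reach r d E" "live E = {}" by blast
    have "Suc r \<le> d * card (\<Union>H)" "card (\<Union>E) \<le> card (\<Union>H) * (1 + 2 * (r + d))"
      using reach_bounds[OF *(2)] *(3) by auto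
    moreover have "d * card (\<Union>H) \<le> K * card (\<Union>H)" using *(1) by (intro mult_le_mono1) auto
    ultimately have "r + d \<le> K * card (\<Union>H) + K" using *(1) by linarith
    then have "1 + 2 * (r + d) \<le> 1 + 2 * (K * card (\<Union>H) + K)" by simp
    then have "card (\<Union>H) * (1 + 2 * (r + d)) \<le> card (\<Union>H) * (1 + 2 * (K * card (\<Union>H) + K))"
      by (rule mult_le_mono2)
    with \<open>card (\<Union>E) \<le> _\<close> show thesis by (intro small) (rule le_trans)
  qed
qed

end

section \<open>Weights of the explored sets\<close>

lemma sum_UN_bound:
  fixes f :: "'b \<Rightarrow> real"
  assumes "finite I" "\<And>i. i \<in> I \<Longrightarrow> finite (A i)" "X \<subseteq> (\<Union>i\<in>I. A i)" "\<And>x. 0 \<le> f x"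
  shows "sum f X \<le> (\<Sum>i\<in>I. sum f (A i))"
proof -
  have "sum f (\<Union>i\<in>I. A i) \<le> (\<Sum>i\<in>I. sum f (A i))"
    using assms(1,2)
  proof (induction I rule: finite_induct)
    case (insert j I)
    have "sum f (A j \<union> (\<Union>i\<in>I. A i)) \<le> sum f (A j) + sum f (\<Union>i\<in>I. A i)"
      using insert.hyps insert.prems assms(4)
      by (subst sum_Un) (auto intro!: sum_nonneg)
    then show ?case using insert by fastforce
  qed simp
  moreover have "sum f X \<le> sum f (\<Union>i\<in>I. A i)"
    using assms by (intro sum_mono2) auto
  ultimately show ?thesis by linarith
qed

context pattern begin

section \<open>Counting copies by their overlap with a vertex set\<close>

definition copies_in :: "nat \<Rightarrow> nat set set set" where
  "copies_in n = {D \<in> copies. D \<subseteq> potential_edges n}"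

lemma finite_potential_edges: "finite (potential_edges n)"
  by (rule finite_subset[of _ "Pow {..<n}"]) (auto simp: potential_edges_def)

lemma finite_copies_in: "finite (copies_in n)"
  by (rule finite_subset[of _ "Pow (potential_edges n)"])
    (auto simp: copies_in_def finite_potential_edges)

text \<open>At most \<open>2 ^ v\<close> choices of which j vertices of H go into U, then arbitrary
  maps. It is applied with the ends of an edge as U, with the explored vertices as U, and with
  \<open>j = 0\<close> to count all copies.\<close>

lemma card_copies_meeting:
  assumes U: "finite U"
  shows "card {D \<in> copies_in n. j \<le> card (\<Union>D \<inter> U)}
    \<le> 2 ^ card (\<Union>H) * card U ^ j * n ^ (card (\<Union>H) - j)"
proof -
  let ?V = "\<Union>H"
  define Ws where "Ws = {W. W \<subseteq> ?V \<and> card W = j}"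
  define P where "P W = (\<Pi>\<^sub>E x\<in>?V. if x \<in> W then U else {..<n})" for W
  have finV: "finite ?V" by (rule finite_Union_H)
  have finWs: "finite Ws" using finV by (auto simp: Ws_def)
  have finP: "finite (P W)" for W unfolding P_def using finV U by (intro finite_PiE) auto
  have cardP: "card (P W) = card U ^ j * n ^ (card ?V - j)" if "W \<in> Ws" for W
  proof -
    have W: "W \<subseteq> ?V" "card W = j" using that by (auto simp: Ws_def)
    have "card (P W) = (\<Prod>x\<in>?V. if x \<in> W then card U else n)"
      unfolding P_def card_PiE[OF finV] by (intro prod.cong) auto
    also have "\<dots> = card U ^ card (?V \<inter> W) * n ^ card (?V - W)"
      by (subst prod.If_cases[OF finV]) (simp add: Diff_eq)
    also have "?V \<inter> W = W" using W by blast
    also have "card (?V - W) = card ?V - j" using W finV by (metis card_Diff_subset finite_subset)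
    finally show ?thesis using W by simp
  qed
  have sub: "{D \<in> copies_in n. j \<le> card (\<Union>D \<inter> U)} \<subseteq> (\<lambda>\<phi>. (\<lambda>e. \<phi> ` e) ` H) ` (\<Union>W\<in>Ws. P W)"
  proof
    fix D assume D: "D \<in> {D \<in> copies_in n. j \<le> card (\<Union>D \<inter> U)}"
    then obtain \<phi> where \<phi>: "inj_on \<phi> ?V" "D = (\<lambda>e. \<phi> ` e) ` H"
      by (auto simp: copies_in_def elim: copyE)
    have UD: "\<Union>D = \<phi> ` ?V" using \<phi>(2) by blast
    have "\<Union>D \<subseteq> {..<n}" using D by (auto simp: copies_in_def potential_edges_def)
    then have bound: "\<phi> x \<in> {..<n}" if "x \<in> ?V" for x
      unfolding UD using that by (auto simp only: image_subset_iff)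
    have "f ` A \<inter> B = f ` {x \<in> A. f x \<in> B}" for f :: "'a \<Rightarrow> nat" and A B by auto
    then have "\<Union>D \<inter> U = \<phi> ` {x \<in> ?V. \<phi> x \<in> U}" unfolding UD .
    moreover have "inj_on \<phi> {x \<in> ?V. \<phi> x \<in> U}" using \<phi>(1) by (rule inj_on_subset) auto
    ultimately have "j \<le> card {x \<in> ?V. \<phi> x \<in> U}" using D by (simp add: card_image)
    then obtain W where W: "W \<subseteq> {x \<in> ?V. \<phi> x \<in> U}" "card W = j"
      using obtain_subset_with_card_n by metis
    define \<psi> where "\<psi> = restrict \<phi> ?V"
    have "\<phi> x \<in> (if x \<in> W then U else {..<n})" if x: "x \<in> ?V" for x
    proof (cases "x \<in> W")
      case True
      then show ?thesis using W(1) by auto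
    qed (use bound[OF x] in simp)
    then have "\<psi> \<in> P W" unfolding P_def \<psi>_def by (intro restrict_PiE_iff[THEN iffD2] ballI)
    moreover have "W \<in> Ws" using W by (auto simp: Ws_def)
    moreover have "\<psi> ` e = \<phi> ` e" if "e \<in> H" for e
      unfolding \<psi>_def using that by (intro image_cong) auto
    then have "D = (\<lambda>e. \<psi> ` e) ` H" using \<phi>(2) by simp
    ultimately show "D \<in> (\<lambda>\<phi>. (\<lambda>e. \<phi> ` e) ` H) ` (\<Union>W\<in>Ws. P W)" by blast
  qed
  have "card {D \<in> copies_in n. j \<le> card (\<Union>D \<inter> U)} \<le> card ((\<lambda>\<phi>. (\<lambda>e. \<phi> ` e) ` H) ` (\<Union>W\<in>Ws. P W))"
    using sub finWs finP by (intro card_mono) auto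
  also have "\<dots> \<le> card (\<Union>W\<in>Ws. P W)" using finWs finP by (intro card_image_le) auto
  also have "\<dots> \<le> (\<Sum>W\<in>Ws. card (P W))" by (rule card_UN_le[OF finWs])
  also have "\<dots> = card Ws * (card U ^ j * n ^ (card ?V - j))" using cardP by simp
  also have "\<dots> \<le> 2 ^ card ?V * (card U ^ j * n ^ (card ?V - j))"
  proof (rule mult_le_mono1)
    have "card Ws \<le> card (Pow ?V)" using finV by (intro card_mono) (auto simp: Ws_def)
    then show "card Ws \<le> 2 ^ card ?V" using finV by (simp add: card_Pow)
  qed
  finally show ?thesis by (simp add: mult.assoc)
qed

text \<open>Here b and u stand for the numbers of common edges and vertices of a degenerate overlap.
  Only finitely many pairs occur, so the saving in the exponent of n is bounded below independently
  of n. The 1 inserted into the minimum covers an empty set of pairs.\<close>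

lemma gap_exists:
  "\<exists>\<epsilon>>0. \<forall>b\<in>{1..card H}. \<forall>u\<in>{..card (\<Union>H)}.
      real b - 1 < m * (real u - 2) \<longrightarrow> \<epsilon> \<le> (real u - 2) - (real b - 1) / m"
proof -
  define A where "A = {(b,u). b \<in> {1..card H} \<and> u \<in> {..card (\<Union>H)} \<and> real b - 1 < m * (real u - 2)}"
  define h where "h = (\<lambda>(b,u). (real u - 2) - (real b - 1) / m)"
  have fin: "finite A"
    by (rule finite_subset[of _ "{1..card H} \<times> {..card (\<Union>H)}"]) (auto simp: A_def)
  have pos: "0 < h x" if "x \<in> A" for x
    using that m_gt_1 by (auto simp: A_def h_def field_simps)
  define \<epsilon> where "\<epsilon> = Min (insert 1 (h ` A))"
  have "0 < \<epsilon>" using fin pos by (auto simp: \<epsilon>_def)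
  moreover have "\<epsilon> \<le> h x" if "x \<in> A" for x using fin that by (auto simp: \<epsilon>_def)
  ultimately show ?thesis by (intro exI[of _ \<epsilon>]) (force simp: A_def h_def)
qed

end

locale weighted_pattern = pattern H m for H :: "'a set set" and m :: real +
  fixes c \<epsilon> :: real and n :: nat
  assumes c: "0 < c" "c \<le> 1" and n: "1 \<le> n" and eps: "0 < \<epsilon>"
    and gap: "b \<in> {1..card H} \<Longrightarrow> u \<in> {..card (\<Union>H)} \<Longrightarrow>
      real b - 1 < m * (real u - 2) \<Longrightarrow> \<epsilon> \<le> (real u - 2) - (real b - 1) / m"
begin

section \<open>First-moment cost of a single attachment\<close>

definition q :: real where "q = c * real n powr (- 1 / m)"

text \<open>The expected number of members of the family contained in \<open>G(n,q)\<close>, where q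
  is the largest edge probability allowed.\<close>

definition weight :: "nat set set set \<Rightarrow> real" where
  "weight \<A> = (\<Sum>S\<in>\<A>. q ^ card S)"

abbreviation eH :: real where "eH \<equiv> real (card H)"
abbreviation vH :: real where "vH \<equiv> real (card (\<Union>H))"
abbreviation inside :: "nat set set set" where "inside \<equiv> Pow (potential_edges n)"

lemma q_nonneg: "0 \<le> q"
  using c by (simp add: q_def)

lemma q_power: "q ^ k = c ^ k * real n powr (- real k / m)"
  using n by (simp add: q_def power_mult_distrib powr_realpow[symmetric] powr_powr)

lemma q_power_le: "q ^ k \<le> real n powr (- real k / m)"
  unfolding q_power using c power_le_one[of c k] by (simp add: mult_left_le_one_le)

lemma n_power: "real n ^ k = real n powr real k"
  using n by (simp add: powr_realpow)

lemma eH_eq: "(eH - 1) / m = vH - 2"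
  using density_H m_gt_1 by (simp add: field_simps)

lemma card_Un_new: "finite S \<Longrightarrow> finite D \<Longrightarrow> card (S \<union> D) = card S + card (D - S)"
  by (metis Diff_disjoint Un_Diff_cancel card_Un_disjoint finite_Diff)

text \<open>Cost of one regular attachment: there are at most
  \<open>2 ^ v * 2 ^ 2 * n ^ (v - 2)\<close> copies through the two ends of a given edge, and the
  powers of n cancel against \<open>q ^ (e - 1)\<close>, leaving \<open>c ^ (e - 1)\<close>.\<close>

definition rho :: real where "rho = 2 ^ (card (\<Union>H) + 2) * c ^ (card H - 1)"

lemma rho_nonneg: "0 \<le> rho" using c by (simp add: rho_def)

lemma regular_weight:
  assumes S: "finite S" "g \<in> S" "card g = 2"
  shows "(\<Sum>D\<in>regular S g \<inter> copies_in n. q ^ card (S \<union> D)) \<le> rho * q ^ card S"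
proof -
  \<comment> \<open>The common vertices of D and S are the two ends of g, so no edge of D except g
    can lie in S.\<close>
  have one: "card (D - S) = card H - 1" if D: "D \<in> regular S g" for D
  proof -
    have DS: "D \<in> copies" "g \<in> D" "\<Union>D \<inter> \<Union>S = g" using D by (simp_all add: regular_def)
    have "h = g" if h: "h \<in> D" "h \<in> S" for h
    proof -
      have "h \<subseteq> g" using h DS(3) by blast
      moreover have "finite g" using S(3) card.infinite by force
      ultimately show ?thesis using S(3) card_edge_copy[OF DS(1) h(1)] by (metis card_subset_eq)
    qed
    then have "D - S = D - {g}" using S(2) by blast
    then show ?thesis using DS finite_copy card_copy by simp
  qed
  have "q ^ card (S \<union> D) = q ^ card S * q ^ (card H - 1)" if "D \<in> regular S g \<inter> copies_in n" for D
    using that card_Un_new[OF S(1), of D] one finite_copy regular_copy by (auto simp: power_add)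
  then have "(\<Sum>D\<in>regular S g \<inter> copies_in n. q ^ card (S \<union> D))
      = real (card (regular S g \<inter> copies_in n)) * (q ^ card S * q ^ (card H - 1))"
    by simp
  also have "\<dots> \<le> (2 ^ (card (\<Union>H) + 2) * real n ^ (card (\<Union>H) - 2)) * (q ^ card S * q ^ (card H - 1))"
  proof (rule mult_right_mono)
    have "finite g" using S(3) card.infinite by force
    have "regular S g \<inter> copies_in n \<subseteq> {D \<in> copies_in n. 2 \<le> card (\<Union>D \<inter> g)}"
    proof
      fix D assume D: "D \<in> regular S g \<inter> copies_in n"
      then have "\<Union>D \<inter> g = g" by (auto simp: regular_def)
      then show "D \<in> {D \<in> copies_in n. 2 \<le> card (\<Union>D \<inter> g)}" using D S(3) by simp
    qed
    then have "card (regular S g \<inter> copies_in n) \<le> card {D \<in> copies_in n. 2 \<le> card (\<Union>D \<inter> g)}"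
      by (intro card_mono) (auto simp: finite_copies_in)
    also have "\<dots> \<le> 2 ^ card (\<Union>H) * card g ^ 2 * n ^ (card (\<Union>H) - 2)"
      by (rule card_copies_meeting) fact
    also have "\<dots> = 2 ^ (card (\<Union>H) + 2) * n ^ (card (\<Union>H) - 2)" using S(3) by (simp add: power_add)
    finally show "real (card (regular S g \<inter> copies_in n)) \<le> 2 ^ (card (\<Union>H) + 2) * real n ^ (card (\<Union>H) - 2)"
      by (metis (mono_tags) of_nat_le_iff of_nat_mult of_nat_numeral of_nat_power)
  qed (use q_nonneg in simp)
  also have "\<dots> = rho * q ^ card S * (real n ^ (card (\<Union>H) - 2) * real n powr (- real (card H - 1) / m))"
    unfolding q_power[of "card H - 1"] rho_def by simp
  \<comment> \<open>The point where the threshold exponent is exact: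
    \<open>(e - 1) / m = v - 2\<close>.\<close>
  also have "real n ^ (card (\<Union>H) - 2) * real n powr (- real (card H - 1) / m) = 1"
  proof -
    have "real (card H - 1) / m = real (card (\<Union>H) - 2)"
      using eH_eq five_edges v_ge_4 by (simp add: of_nat_diff)
    then have "- real (card H - 1) / m = - real (card (\<Union>H) - 2)" by simp
    then show ?thesis using n by (simp only: n_power powr_add[symmetric]) simp
  qed
  finally show ?thesis by simp
qed

text \<open>Cost of one degenerate attachment to a set with at most s vertices:
  \<open>vH + 1\<close> possible numbers of common vertices, at most \<open>s ^ v\<close> places for
  these vertices, and the gap \<open>\<epsilon>\<close> in the exponent.\<close>

definition delta0 :: "real \<Rightarrow> real" where
  "delta0 s = (vH + 1) * 2 ^ card (\<Union>H) * s ^ card (\<Union>H) * real n powr (- \<epsilon>)"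

text \<open>Placing the vertices of D outside S costs \<open>n ^ (v - u)\<close>. Strict density of
  the common edges makes the new edges outweigh this by \<open>n powr (- \<epsilon>)\<close>; for a
  single common edge the inequality comes from u > 2 instead.\<close>

lemma degenerate_gap:
  assumes D: "D \<in> degenerate S" and S: "finite S"
  shows "q ^ card (D - S) \<le> real n powr (- (vH - real (card (\<Union>D \<inter> \<Union>S))) - \<epsilon>)"
    and "card (\<Union>D \<inter> \<Union>S) \<le> card (\<Union>H)"
proof -
  define b where "b = card (D \<inter> S)"
  define u where "u = card (\<Union>D \<inter> \<Union>S)"
  have DS: "D \<in> copies" "D \<inter> S \<noteq> {}" "\<not> D \<subseteq> S" "2 < u"
    using D by (simp_all add: degenerate_def u_def)
  have fin: "finite D" "finite (\<Union>D)" using DS finite_copy finite_Union_copy by auto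
  have b: "1 \<le> b" "b \<le> card H"
    using DS(2) fin card_mono[of D "D \<inter> S"] card_copy[OF DS(1)]
    by (auto simp: b_def Suc_le_eq card_gt_0_iff)
  show u: "u \<le> card (\<Union>H)"
    unfolding u_def card_Union_copy[OF DS(1), symmetric] using fin(2) by (intro card_mono) auto
  have lt: "real b - 1 < m * (real u - 2)"
  proof (cases "b = 1")
    case True
    then show ?thesis using DS(4) m_gt_1 by simp
  next
    case False
    then have "real b - 1 < m * (real (card (\<Union>(D \<inter> S))) - 2)"
      unfolding b_def using b DS(3) by (intro density_copy_less[OF DS(1)]) (auto simp: b_def)
    also have "card (\<Union>(D \<inter> S)) \<le> u"
      unfolding u_def using fin(2) by (intro card_mono) auto
    then have "m * (real (card (\<Union>(D \<inter> S))) - 2) \<le> m * (real u - 2)" using m_gt_1 by simp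
    finally show ?thesis .
  qed
  have eps_le: "\<epsilon> \<le> (real u - 2) - (real b - 1) / m" using gap[of b u] lt b u by simp
  have "card (D - S) = card H - b"
    using card_Diff_subset_Int[of D S] fin card_copy[OF DS(1)] by (simp add: b_def)
  then have "- real (card (D - S)) / m = - (eH - 1) / m + (real b - 1) / m"
    using b by (simp add: of_nat_diff diff_divide_distrib add_divide_distrib)
  moreover have "- (eH - 1) / m = - (vH - 2)" using eH_eq by (metis minus_divide_left)
  ultimately have "- real (card (D - S)) / m = - (vH - 2) + (real b - 1) / m" by (simp only:)
  then have "- real (card (D - S)) / m \<le> - (vH - real u) - \<epsilon>" using eps_le by linarith
  then have "real n powr (- real (card (D - S)) / m) \<le> real n powr (- (vH - real u) - \<epsilon>)"
    using n by (intro powr_mono) auto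
  then show "q ^ card (D - S) \<le> real n powr (- (vH - real u) - \<epsilon>)"
    using q_power_le[of "card (D - S)"] by linarith
qed

lemma degenerate_weight:
  assumes S: "finite S" "\<And>e. e \<in> S \<Longrightarrow> card e = 2" and s: "real (card (\<Union>S)) \<le> s" "1 \<le> s"
  shows "(\<Sum>D\<in>degenerate S \<inter> copies_in n. q ^ card (S \<union> D)) \<le> delta0 s * q ^ card S"
proof -
  let ?A = "\<lambda>u. {D \<in> degenerate S \<inter> copies_in n. card (\<Union>D \<inter> \<Union>S) = u}"
  have finS: "finite (\<Union>S)" using S card.infinite by (intro finite_Union) force+
  have inner: "(\<Sum>D\<in>?A u. q ^ card (D - S)) \<le> 2 ^ card (\<Union>H) * s ^ card (\<Union>H) * real n powr (- \<epsilon>)"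
    if u: "u \<in> {..card (\<Union>H)}" for u
  proof -
    have "(\<Sum>D\<in>?A u. q ^ card (D - S)) \<le> (\<Sum>D\<in>?A u. real n powr (- (vH - real u) - \<epsilon>))"
      using degenerate_gap(1)[OF _ S(1)] by (intro sum_mono) auto
    also have "\<dots> = real (card (?A u)) * real n powr (- (vH - real u) - \<epsilon>)" by simp
    also have "\<dots> \<le> (2 ^ card (\<Union>H) * s ^ card (\<Union>H) * real n ^ (card (\<Union>H) - u))
        * real n powr (- (vH - real u) - \<epsilon>)"
    proof (rule mult_right_mono)
      have "card (?A u) \<le> card {D \<in> copies_in n. u \<le> card (\<Union>D \<inter> \<Union>S)}"
        by (intro card_mono) (auto simp: finite_copies_in)
      also have "\<dots> \<le> 2 ^ card (\<Union>H) * card (\<Union>S) ^ u * n ^ (card (\<Union>H) - u)"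
        by (rule card_copies_meeting[OF finS])
      finally have "real (card (?A u)) \<le> 2 ^ card (\<Union>H) * real (card (\<Union>S)) ^ u * real n ^ (card (\<Union>H) - u)"
        by (metis (mono_tags) of_nat_le_iff of_nat_mult of_nat_numeral of_nat_power)
      also have "\<dots> \<le> 2 ^ card (\<Union>H) * s ^ card (\<Union>H) * real n ^ (card (\<Union>H) - u)"
      proof (intro mult_right_mono mult_left_mono)
        have "real (card (\<Union>S)) ^ u \<le> s ^ u" using s by (intro power_mono) auto
        also have "\<dots> \<le> s ^ card (\<Union>H)" using s u by (intro power_increasing) auto
        finally show "real (card (\<Union>S)) ^ u \<le> s ^ card (\<Union>H)" .
      qed auto
      finally show "real (card (?A u)) \<le> 2 ^ card (\<Union>H) * s ^ card (\<Union>H) * real n ^ (card (\<Union>H) - u)" .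
    qed simp
    also have "\<dots> = 2 ^ card (\<Union>H) * s ^ card (\<Union>H) * (real n ^ (card (\<Union>H) - u) * real n powr (- (vH - real u) - \<epsilon>))"
      by simp
    also have "real n ^ (card (\<Union>H) - u) * real n powr (- (vH - real u) - \<epsilon>) = real n powr (- \<epsilon>)"
      unfolding n_power powr_add[symmetric] using u by (simp add: of_nat_diff)
    finally show ?thesis .
  qed
  have "(\<Sum>D\<in>degenerate S \<inter> copies_in n. q ^ card (D - S))
      \<le> (\<Sum>u\<in>{..card (\<Union>H)}. \<Sum>D\<in>?A u. q ^ card (D - S))"
    using degenerate_gap(2)[OF _ S(1)] q_nonneg
    by (intro sum_UN_bound) (auto simp: finite_copies_in)
  also have "\<dots> \<le> (\<Sum>u\<in>{..card (\<Union>H)}. 2 ^ card (\<Union>H) * s ^ card (\<Union>H) * real n powr (- \<epsilon>))"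
    by (rule sum_mono[OF inner])
  also have "\<dots> = delta0 s" by (simp add: delta0_def)
  finally have *: "(\<Sum>D\<in>degenerate S \<inter> copies_in n. q ^ card (D - S)) \<le> delta0 s" .
  have "(\<Sum>D\<in>degenerate S \<inter> copies_in n. q ^ card (S \<union> D))
     = q ^ card S * (\<Sum>D\<in>degenerate S \<inter> copies_in n. q ^ card (D - S))"
    unfolding sum_distrib_left
    by (intro sum.cong) (auto simp: card_Un_new[OF S(1)] finite_copy copies_in_def power_add)
  also have "\<dots> \<le> q ^ card S * delta0 s" using * q_nonneg by (intro mult_left_mono) auto
  finally show ?thesis by (simp add: mult.commute)
qed

section \<open>Weight of all sets reachable in given numbers of rounds\<close>

definition level :: "nat \<Rightarrow> nat \<Rightarrow> nat set set set" where
  "level r d = {S \<in> inside. reach r d S}"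

lemma finite_inside: "finite inside"
  by (simp add: finite_potential_edges)

lemma finite_level: "finite (level r d)"
  by (rule finite_subset[OF _ finite_inside]) (auto simp: level_def)

lemma weight_UN:
  assumes "finite I" "\<And>i. i \<in> I \<Longrightarrow> finite (A i)" "X \<subseteq> (\<Union>i\<in>I. A i)"
    and "\<And>i. i \<in> I \<Longrightarrow> weight (A i) \<le> b i"
  shows "weight X \<le> sum b I"
proof -
  have "weight X \<le> (\<Sum>i\<in>I. weight (A i))"
    unfolding weight_def using assms q_nonneg by (intro sum_UN_bound) auto
  also have "\<dots> \<le> sum b I" using assms(4) by (rule sum_mono)
  finally show ?thesis .
qed

lemma weight_image: "finite A \<Longrightarrow> weight ((\<lambda>D. S \<union> D) ` A) \<le> (\<Sum>D\<in>A. q ^ card (S \<union> D))"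
  unfolding weight_def using sum_image_le[of A "\<lambda>S. q ^ card S" "\<lambda>D. S \<union> D"] q_nonneg
  by (simp add: o_def)

lemma finite_regular_in: "finite (regular S g \<inter> copies_in n)"
  and finite_degenerate_in: "finite (degenerate S \<inter> copies_in n)"
  using finite_copies_in by auto

lemma in_copies_inI: "D \<in> copies \<Longrightarrow> T \<union> D \<in> inside \<Longrightarrow> D \<in> copies_in n"
  by (auto simp: copies_in_def)

lemma regular_image_weight:
  assumes "finite S" "g \<in> S" "card g = 2"
  shows "weight ((\<lambda>D. S \<union> D) ` (regular S g \<inter> copies_in n)) \<le> rho * q ^ card S"
  using weight_image[OF finite_regular_in] regular_weight[OF assms] by (rule order_trans)

lemma degenerate_image_weight:
  assumes "finite S" "\<And>e. e \<in> S \<Longrightarrow> card e = 2" "real (card (\<Union>S)) \<le> s" "1 \<le> s"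
  shows "weight ((\<lambda>D. S \<union> D) ` (degenerate S \<inter> copies_in n)) \<le> delta0 s * q ^ card S"
  using weight_image[OF finite_degenerate_in] degenerate_weight[OF assms] by (rule order_trans)

text \<open>Without a live copy the attaching edge is free, which brings in the factor
  \<open>card S\<close>, growing with the exploration.\<close>

lemma up_weight_dead:
  assumes S: "finite S" "\<And>e. e \<in> S \<Longrightarrow> card e = 2" and dead: "live S = {}"
  shows "weight (up S \<inter> inside) \<le> real (card S) * rho * q ^ card S"
proof -
  have "weight (up S \<inter> inside) \<le> (\<Sum>g\<in>S. rho * q ^ card S)"
  proof (rule weight_UN[OF S(1)])
    show "up S \<inter> inside \<subseteq> (\<Union>g\<in>S. (\<lambda>D. S \<union> D) ` (regular S g \<inter> copies_in n))"
    proof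
      fix S' assume S': "S' \<in> up S \<inter> inside"
      then obtain D g where D: "S' = S \<union> D" "g \<in> S" "D \<in> regular S g"
        using dead by (auto simp: up_def)
      then have "D \<in> copies_in n" using in_copies_inI regular_copy S' by blast
      then show "S' \<in> (\<Union>g\<in>S. (\<lambda>D. S \<union> D) ` (regular S g \<inter> copies_in n))" using D by blast
    qed
  qed (use S regular_image_weight finite_regular_in in auto)
  then show ?thesis by simp
qed

text \<open>Both attaching edges lie in the copy determined by S, so there are only
  \<open>eH^2\<close> choices for them, however large S is.\<close>

lemma up_weight_live:
  assumes S: "finite S" "\<And>e. e \<in> S \<Longrightarrow> card e = 2" and live: "live S \<noteq> {}"
  shows "weight (up S \<inter> inside) \<le> eH\<^sup>2 * rho\<^sup>2 * q ^ card S"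
proof -
  define C where "C = pick S"
  have C: "C \<in> copies" "C \<subseteq> S" "finite C" "card C = card H"
    using live_copy[OF pick_live[OF live]] finite_copy card_copy by (auto simp: C_def)
  let ?Z = "\<lambda>D1 g2. (\<lambda>D2. (S \<union> D1) \<union> D2) ` (regular (S \<union> D1) g2 \<inter> copies_in n)"
  let ?Y = "\<lambda>D1. \<Union>g2\<in>C. ?Z D1 g2"
  let ?X = "\<lambda>g1. \<Union>D1\<in>regular S g1 \<inter> copies_in n. ?Y D1"
  have finY: "finite (?Y D1)" for D1 using C(3) finite_regular_in by auto
  have finX: "finite (?X g1)" for g1 using finY finite_regular_in by auto
  have Y: "weight (?Y D1) \<le> eH * rho * q ^ card (S \<union> D1)" if D1: "D1 \<in> regular S g1" for D1 g1
  proof -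
    have "weight (?Y D1) \<le> (\<Sum>g2\<in>C. rho * q ^ card (S \<union> D1))"
    proof (rule weight_UN[OF C(3) _ subset_refl])
      fix g2 assume g2: "g2 \<in> C"
      have "finite (S \<union> D1)" using S finite_copy[OF regular_copy[OF D1]] by simp
      then show "weight (?Z D1 g2) \<le> rho * q ^ card (S \<union> D1)"
        using g2 C(2) S(2) by (intro regular_image_weight) auto
    qed (use finite_regular_in in simp)
    then show ?thesis by (simp add: C(4))
  qed
  have X: "weight (?X g1) \<le> eH * rho * (rho * q ^ card S)" if g1: "g1 \<in> C" for g1
  proof -
    have "weight (?X g1) \<le> (\<Sum>D1\<in>regular S g1 \<inter> copies_in n. eH * rho * q ^ card (S \<union> D1))"
      using Y finY by (intro weight_UN[OF finite_regular_in _ subset_refl]) auto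
    also have "\<dots> = eH * rho * (\<Sum>D1\<in>regular S g1 \<inter> copies_in n. q ^ card (S \<union> D1))"
      by (simp add: sum_distrib_left)
    also have "\<dots> \<le> eH * rho * (rho * q ^ card S)"
      using regular_weight[OF S(1), of g1] g1 C(2) S(2) rho_nonneg by (intro mult_left_mono) auto
    finally show ?thesis .
  qed
  have "weight (up S \<inter> inside) \<le> (\<Sum>g1\<in>C. eH * rho * (rho * q ^ card S))"
  proof (rule weight_UN[OF C(3) finX _ X])
    show "up S \<inter> inside \<subseteq> (\<Union>g1\<in>C. ?X g1)"
    proof
      fix S' assume S': "S' \<in> up S \<inter> inside"
      then obtain D1 D2 g1 g2 where D: "S' = S \<union> D1 \<union> D2" "g1 \<in> C" "g2 \<in> C"
        "D1 \<in> regular S g1" "D2 \<in> regular (S \<union> D1) g2"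
        using live unfolding C_def up_def by auto
      have "S \<union> D1 \<in> inside" "S \<union> D1 \<union> D2 \<in> inside" using S' D(1) by auto
      then have "D1 \<in> regular S g1 \<inter> copies_in n" "D2 \<in> regular (S \<union> D1) g2 \<inter> copies_in n"
        using D in_copies_inI regular_copy by blast+
      then have "S' \<in> ?Z D1 g2" using D(1) by (intro image_eqI) auto
      then have "S' \<in> ?Y D1" using D(3) by (rule UN_I[rotated])
      then have "S' \<in> ?X g1" using \<open>D1 \<in> regular S g1 \<inter> _\<close> by (rule UN_I[rotated])
      then show "S' \<in> (\<Union>g1\<in>C. ?X g1)" using D(2) by (rule UN_I[rotated])
    qed
  qed
  then show ?thesis by (simp add: C(4) power2_eq_square mult_ac)
qed

text \<open>The summand vH in the bound on s leaves room for the regular copy that may precede the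
  degenerate one.\<close>

lemma down_weight:
  assumes S: "finite S" "\<And>e. e \<in> S \<Longrightarrow> card e = 2"
    and s: "real (card (\<Union>S)) + vH \<le> s" "1 \<le> s"
  shows "weight (down S \<inter> inside) \<le> (1 + eH * rho) * delta0 s * q ^ card S"
proof -
  define C where "C = (if live S = {} then {} else pick S)"
  have C: "C \<subseteq> S" "finite C" "card C \<le> card H"
    using live_copy[OF pick_live[of S]] finite_copy card_copy by (auto simp: C_def)
  have d0: "0 \<le> delta0 s" using s by (simp add: delta0_def)
  let ?A = "(\<lambda>D. S \<union> D) ` (degenerate S \<inter> copies_in n)"
  let ?Z = "\<lambda>D1. (\<lambda>D2. (S \<union> D1) \<union> D2) ` (degenerate (S \<union> D1) \<inter> copies_in n)"
  let ?X = "\<lambda>g1. \<Union>D1\<in>regular S g1 \<inter> copies_in n. ?Z D1"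
  let ?B = "\<Union>g1\<in>C. ?X g1"
  have finX: "finite (?X g1)" for g1 using finite_degenerate_in finite_regular_in by auto
  have A: "weight ?A \<le> delta0 s * q ^ card S"
    using s by (intro degenerate_image_weight S) auto
  have X: "weight (?X g1) \<le> delta0 s * (rho * q ^ card S)" if g1: "g1 \<in> C" for g1
  proof -
    have "weight (?X g1) \<le> (\<Sum>D1\<in>regular S g1 \<inter> copies_in n. delta0 s * q ^ card (S \<union> D1))"
    proof (rule weight_UN[OF finite_regular_in _ subset_refl])
      fix D1 assume "D1 \<in> regular S g1 \<inter> copies_in n"
      then have D1: "D1 \<in> copies" using regular_copy by blast
      have "\<Union>(S \<union> D1) = \<Union>S \<union> \<Union>D1" by blast
      then have "real (card (\<Union>(S \<union> D1))) \<le> s"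
        using card_Un_le[of "\<Union>S" "\<Union>D1"] card_Union_copy[OF D1] s(1) by simp
      then show "weight (?Z D1) \<le> delta0 s * q ^ card (S \<union> D1)"
        using S finite_copy[OF D1] card_edge_copy[OF D1] s(2)
        by (intro degenerate_image_weight) auto
    qed (use finite_degenerate_in in simp)
    also have "\<dots> = delta0 s * (\<Sum>D1\<in>regular S g1 \<inter> copies_in n. q ^ card (S \<union> D1))"
      by (simp add: sum_distrib_left)
    also have "\<dots> \<le> delta0 s * (rho * q ^ card S)"
      using regular_weight[OF S(1), of g1] g1 C(1) S(2) d0 by (intro mult_left_mono) auto
    finally show ?thesis .
  qed
  have "weight ?B \<le> (\<Sum>g1\<in>C. delta0 s * (rho * q ^ card S))"
    by (rule weight_UN[OF C(2) finX subset_refl X])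
  also have "\<dots> = real (card C) * (delta0 s * (rho * q ^ card S))" by simp
  also have "\<dots> \<le> eH * (delta0 s * (rho * q ^ card S))"
    using C(3) d0 rho_nonneg q_nonneg by (intro mult_right_mono) auto
  finally have B: "weight ?B \<le> eH * (delta0 s * (rho * q ^ card S))" .
  have sub: "down S \<inter> inside \<subseteq> ?A \<union> ?B"
  proof
    fix S' assume S': "S' \<in> down S \<inter> inside"
    then consider D where "S' = S \<union> D" "D \<in> degenerate S"
      | D1 D2 g1 where "S' = S \<union> D1 \<union> D2" "live S \<noteq> {}" "g1 \<in> pick S" "D1 \<in> regular S g1"
        "D2 \<in> degenerate (S \<union> D1)"
      unfolding down_def by blast
    then show "S' \<in> ?A \<union> ?B"
    proof cases
      case 1
      then have "D \<in> copies_in n" using in_copies_inI degenerate_copy S' by blast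
      then show ?thesis using 1 by blast
    next
      case 2
      have "S \<union> D1 \<in> inside" "S \<union> D1 \<union> D2 \<in> inside" using S' 2(1) by auto
      then have mem: "D1 \<in> regular S g1 \<inter> copies_in n" "D2 \<in> degenerate (S \<union> D1) \<inter> copies_in n"
        using 2 in_copies_inI regular_copy degenerate_copy by blast+
      then have "S' \<in> ?Z D1" using 2(1) by (intro image_eqI) auto
      then have "S' \<in> ?X g1" using mem(1) by (rule UN_I[rotated])
      moreover have "g1 \<in> C" using 2 by (simp add: C_def)
      ultimately have "S' \<in> ?B" by (rule UN_I[rotated])
      then show ?thesis by (rule UnI2)
    qed
  qed
  have finA: "finite ?A" "finite ?B" using finite_degenerate_in finX C(2) by auto
  have "weight (down S \<inter> inside) \<le> weight (?A \<union> ?B)"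
    unfolding weight_def using sub finA q_nonneg by (intro sum_mono2) auto
  also have "\<dots> \<le> weight ?A + weight ?B"
    unfolding weight_def using finA q_nonneg by (subst sum_Un) (auto intro!: sum_nonneg)
  also have "\<dots> \<le> (1 + eH * rho) * delta0 s * q ^ card S"
    using A B by (simp add: algebra_simps)
  finally show ?thesis .
qed

text \<open>The true exponent is \<open>v - e / m = 2 - 1 / m\<close>, rounded up to 2.\<close>

lemma copies_in_weight: "weight (copies_in n) \<le> 2 ^ card (\<Union>H) * (real n)\<^sup>2"
proof -
  have "weight (copies_in n) = real (card (copies_in n)) * q ^ card H"
    unfolding weight_def by (simp add: copies_in_def card_copy)
  also have "\<dots> \<le> (2 ^ card (\<Union>H) * real n ^ card (\<Union>H)) * real n powr (- eH / m)"
  proof (rule mult_mono)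
    have "card (copies_in n) \<le> 2 ^ card (\<Union>H) * n ^ card (\<Union>H)"
      using card_copies_meeting[of "{}" n 0] by simp
    then show "real (card (copies_in n)) \<le> 2 ^ card (\<Union>H) * real n ^ card (\<Union>H)"
      by (metis (mono_tags) of_nat_le_iff of_nat_mult of_nat_numeral of_nat_power)
  qed (use q_power_le q_nonneg in auto)
  also have "\<dots> = 2 ^ card (\<Union>H) * real n powr (vH - eH / m)"
    by (simp add: n_power powr_add[symmetric])
  also have "\<dots> \<le> 2 ^ card (\<Union>H) * real n powr 2"
  proof -
    have "eH / m = (eH - 1) / m + 1 / m" by (simp add: add_divide_distrib[symmetric])
    then have "vH - eH / m \<le> 2" using eH_eq m_gt_1 by simp
    then show ?thesis using n by (intro mult_left_mono powr_mono) auto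
  qed
  also have "real n powr 2 = (real n)\<^sup>2" using n by (simp add: powr_numeral)
  finally show ?thesis .
qed

lemma level_subset:
  "level r d \<subseteq> (if r = 0 \<and> d = 0 then copies_in n else {})
    \<union> (if r = 0 then {} else \<Union>S\<in>level (r - 1) d. up S \<inter> inside)
    \<union> (if d = 0 then {} else \<Union>S\<in>level r (d - 1). down S \<inter> inside)"
proof
  fix S' assume S': "S' \<in> level r d"
  have sub: "S \<in> inside" if "S' \<in> up S \<or> S' \<in> down S" for S
    using step_cases[OF that] S' by (auto simp: level_def)
  have "reach r d S'" "S' \<in> inside" using S' by (auto simp: level_def)
  from this(1) show "S' \<in> (if r = 0 \<and> d = 0 then copies_in n else {})
    \<union> (if r = 0 then {} else \<Union>S\<in>level (r - 1) d. up S \<inter> inside)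
    \<union> (if d = 0 then {} else \<Union>S\<in>level r (d - 1). down S \<inter> inside)"
  proof (cases rule: reach.cases)
    case start
    then show ?thesis using \<open>S' \<in> inside\<close> by (simp add: copies_in_def)
  next
    case (up r' S)
    then have "S \<in> level (r - 1) d" using sub by (simp add: level_def)
    then show ?thesis using up \<open>S' \<in> inside\<close> by auto
  next
    case (down d' S)
    then have "S \<in> level r (d - 1)" using sub by (simp add: level_def)
    then show ?thesis using down \<open>S' \<in> inside\<close> by auto
  qed
qed

lemma weight_UN_level:
  assumes "\<And>S. S \<in> level r d \<Longrightarrow> weight (F S \<inter> inside) \<le> a * q ^ card S"
  shows "weight (\<Union>S\<in>level r d. F S \<inter> inside) \<le> a * weight (level r d)"
proof -
  have "weight (\<Union>S\<in>level r d. F S \<inter> inside) \<le> (\<Sum>S\<in>level r d. a * q ^ card S)"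
    using assms finite_inside by (intro weight_UN[OF finite_level _ subset_refl]) auto
  then show ?thesis by (simp add: weight_def sum_distrib_left)
qed

lemma weight_Un_le:
  assumes "X \<subseteq> A \<union> B" "finite A" "finite B"
  shows "weight X \<le> weight A + weight B"
proof -
  have "weight X \<le> weight (A \<union> B)"
    unfolding weight_def using assms q_nonneg by (intro sum_mono2) auto
  also have "\<dots> \<le> weight A + weight B"
    unfolding weight_def using assms q_nonneg by (subst sum_Un) (auto intro!: sum_nonneg)
  finally show ?thesis .
qed

text \<open>The factor \<open>\<Gamma>\<close> pays for the rounds without a live copy; there are at most
  \<open>d * card (\<Union>H)\<close> of them, since live copies accumulate otherwise.\<close>

lemma level_weight:
  fixes R K :: nat and \<alpha> \<Gamma> \<delta> X :: real
  defines "X \<equiv> real (1 + 2 * (R + K))"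
  assumes \<alpha>: "0 < \<alpha>" "eH\<^sup>2 * rho\<^sup>2 \<le> \<alpha>"
    and \<Gamma>: "1 \<le> \<Gamma>" "eH * X * rho \<le> \<alpha> * \<Gamma>"
    and \<delta>: "(1 + eH * rho) * delta0 (vH * (X + 1)) \<le> \<delta>"
    and rd: "r \<le> R" "d \<le> K"
  shows "weight (level r d)
    \<le> 2 ^ card (\<Union>H) * (real n)\<^sup>2 * (2 * \<alpha>) ^ r * (2 * \<delta>) ^ d * \<Gamma> ^ min r (d * card (\<Union>H))"
  using rd
proof (induction "r + d" arbitrary: r d rule: less_induct)
  case less
  define B where "B = (\<lambda>r d. 2 ^ card (\<Union>H) * (real n)\<^sup>2 * (2 * \<alpha>) ^ r * (2 * \<delta>) ^ d
     * \<Gamma> ^ min r (d * card (\<Union>H)))"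
  have X: "0 \<le> X" "1 \<le> X" by (simp_all add: X_def)
  have vX: "1 \<le> vH * (X + 1)"
    using X v_ge_4 mult_mono[of 1 vH 1 "X + 1"] by simp
  have "0 \<le> (1 + eH * rho) * delta0 (vH * (X + 1))"
    using rho_nonneg X by (intro mult_nonneg_nonneg) (auto simp: delta0_def)
  then have \<delta>0: "0 \<le> \<delta>" using \<delta> by linarith
  have B0: "0 \<le> B r d" for r d using \<alpha> \<Gamma> \<delta>0 by (simp add: B_def)
  have facts: "finite S" "\<And>e. e \<in> S \<Longrightarrow> card e = 2" "real (card S) \<le> eH * X"
    "real (card (\<Union>S)) \<le> vH * X" "Suc r' \<le> card (live S) + d' * card (\<Union>H)"
    if S: "S \<in> level r' d'" and le: "r' \<le> R" "d' \<le> K" for S r' d'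
  proof -
    have b: "finite S \<and> S \<noteq> {} \<and> (\<forall>e\<in>S. card e = 2) \<and>
     card S \<le> card H * (1 + 2 * (r' + d')) \<and> card (\<Union>S) \<le> card (\<Union>H) * (1 + 2 * (r' + d')) \<and>
     Suc r' \<le> card (live S) + d' * card (\<Union>H)"
      using S by (intro reach_bounds) (simp add: level_def)
    have k: "1 + 2 * (r' + d') \<le> 1 + 2 * (R + K)" using le by simp
    have "card S \<le> card H * (1 + 2 * (R + K))" "card (\<Union>S) \<le> card (\<Union>H) * (1 + 2 * (R + K))"
      using b mult_le_mono2[OF k] le_trans by blast+
    then show "real (card S) \<le> eH * X" "real (card (\<Union>S)) \<le> vH * X"
      unfolding X_def of_nat_mult[symmetric] by (simp_all only: of_nat_le_iff)
  qed (use S reach_bounds in \<open>auto simp: level_def\<close>)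
  \<comment> \<open>A level is fed from two predecessors, by a regular or by a degenerate round. The
    factor 2 in \<open>2 * \<alpha>\<close> and \<open>2 * \<delta>\<close> allows each contribution
    half of the bound.\<close>
  define U where "U = (if r = 0 then {} else \<Union>S\<in>level (r - 1) d. up S \<inter> inside)"
  define W where "W = (if d = 0 then {} else \<Union>S\<in>level r (d - 1). down S \<inter> inside)"
  have U: "2 * weight U \<le> B r d"
  proof (cases r)
    case 0
    then show ?thesis using B0 by (simp add: U_def weight_def)
  next
    case (Suc r')
    have IH: "weight (level r' d) \<le> B r' d" using less Suc by (simp add: B_def)
    \<comment> \<open>A set without live copies satisfies
      \<open>Suc r' \<le> d * card (\<Union>H)\<close>, so \<open>\<Gamma>\<close> is charged only
      for such r', precisely when the minimum in its exponent grows.\<close>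
    define a where "a = (if r' < d * card (\<Union>H) then \<alpha> * \<Gamma> else \<alpha>)"
    have "weight (up S \<inter> inside) \<le> a * q ^ card S" if S: "S \<in> level r' d" for S
    proof -
      note F = facts[OF S, OF Suc_leD[OF less.prems(1)[unfolded Suc]] less.prems(2)]
      have q0: "0 \<le> q ^ card S" using q_nonneg by simp
      have "\<alpha> \<le> \<alpha> * \<Gamma>" using \<alpha> \<Gamma> by simp
      show ?thesis
      proof (cases "live S = {}")
        case True
        then have a: "a = \<alpha> * \<Gamma>" using F(5) by (simp add: a_def)
        have "weight (up S \<inter> inside) \<le> real (card S) * rho * q ^ card S"
          by (rule up_weight_dead[OF F(1,2) True])
        also have "\<dots> \<le> eH * X * rho * q ^ card S"
          using F(3) rho_nonneg q0 by (intro mult_right_mono) auto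
        also have "\<dots> \<le> a * q ^ card S" unfolding a using \<Gamma>(2) q0 by (rule mult_right_mono)
        finally show ?thesis .
      next
        case False
        have "weight (up S \<inter> inside) \<le> eH\<^sup>2 * rho\<^sup>2 * q ^ card S"
          by (rule up_weight_live[OF F(1,2) False])
        also have "\<dots> \<le> a * q ^ card S"
          using \<alpha>(2) \<open>\<alpha> \<le> \<alpha> * \<Gamma>\<close> q0 by (intro mult_right_mono) (auto simp: a_def)
        finally show ?thesis .
      qed
    qed
    then have "weight U \<le> a * weight (level r' d)"
      unfolding U_def using Suc weight_UN_level[of r' d up a] by simp
    also have "\<dots> \<le> a * B r' d" using IH \<alpha> \<Gamma> by (intro mult_left_mono) (auto simp: a_def)
    also have "2 * \<dots> = B r d"
    proof (cases "r' < d * card (\<Union>H)")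
      case True
      then have "min r (d * card (\<Union>H)) = Suc (min r' (d * card (\<Union>H)))" using Suc by simp
      then show ?thesis using True unfolding B_def a_def Suc by (simp add: algebra_simps)
    next
      case False
      then have "min r (d * card (\<Union>H)) = min r' (d * card (\<Union>H))" using Suc by simp
      then show ?thesis using False unfolding B_def a_def Suc by (simp add: algebra_simps)
    qed
    finally show ?thesis by simp
  qed
  have W: "2 * weight W \<le> B r d"
  proof (cases d)
    case 0
    then show ?thesis using B0 by (simp add: W_def weight_def)
  next
    case (Suc d')
    have IH: "weight (level r d') \<le> B r d'" using less Suc by (simp add: B_def)
    have "weight (down S \<inter> inside) \<le> \<delta> * q ^ card S" if S: "S \<in> level r d'" for S
    proof -
      note F = facts[OF S less.prems(1), OF Suc_leD[OF less.prems(2)[unfolded Suc]]]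
      have "real (card (\<Union>S)) + vH \<le> vH * (X + 1)" using F(4) by (simp add: algebra_simps)
      then have "weight (down S \<inter> inside) \<le> (1 + eH * rho) * delta0 (vH * (X + 1)) * q ^ card S"
        using vX F(2) by (intro down_weight F(1)) auto
      also have "\<dots> \<le> \<delta> * q ^ card S" using \<delta> q_nonneg by (intro mult_right_mono) auto
      finally show ?thesis .
    qed
    then have "weight W \<le> \<delta> * weight (level r d')"
      unfolding W_def using Suc weight_UN_level[of r d' down \<delta>] by simp
    also have "\<dots> \<le> \<delta> * B r d'" using IH \<delta>0 by (rule mult_left_mono)
    also have "2 * \<dots> \<le> B r d"
    proof -
      have "\<Gamma> ^ min r (d' * card (\<Union>H)) \<le> \<Gamma> ^ min r (d * card (\<Union>H))"
        using \<Gamma> Suc by (intro power_increasing) auto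
      then have "2 ^ card (\<Union>H) * (real n)\<^sup>2 * (2 * \<alpha>) ^ r * (2 * \<delta>) ^ d * \<Gamma> ^ min r (d' * card (\<Union>H)) \<le> B r d"
        unfolding B_def using \<alpha> \<delta>0 by (intro mult_left_mono) auto
      then show ?thesis unfolding B_def Suc by (simp add: algebra_simps)
    qed
    finally show ?thesis by simp
  qed
  have fin: "finite U" "finite W" using finite_level finite_inside by (auto simp: U_def W_def)
  show ?case
  proof (cases "r = 0 \<and> d = 0")
    case True
    then have "level r d \<subseteq> copies_in n \<union> {}" using level_subset[of r d] by simp
    then have "weight (level r d) \<le> weight (copies_in n) + weight {}"
      by (intro weight_Un_le finite_copies_in) auto
    then show ?thesis using True copies_in_weight by (simp add: weight_def)
  next
    case False
    have "level r d \<subseteq> (if r = 0 \<and> d = 0 then copies_in n else {}) \<union> U \<union> W"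
      unfolding U_def W_def by (rule level_subset)
    then have "level r d \<subseteq> U \<union> W" unfolding if_not_P[OF False] Un_empty_left .
    then have "weight (level r d) \<le> weight U + weight W" using fin by (rule weight_Un_le)
    also have "\<dots> \<le> B r d" using U W by linarith
    finally show ?thesis by (simp add: B_def)
  qed
qed

text \<open>R regular rounds at \<open>exp (- 3)\<close> each, or K degenerate ones at
  \<open>n powr (- \<epsilon>)\<close> each, yield \<open>n powr (- 3)\<close> against the initial
  \<open>n^2\<close>. In the exponent of Y, \<open>K * v\<close> comes from the degenerate rounds,
  another \<open>K * v\<close> from the free choices of an attaching edge, and 1 from the number of
  levels in the union.\<close>

lemma exploration_weight:
  fixes R K :: nat and Y :: real
  defines "Y \<equiv> real (2 + 2 * (R + K))"
  assumes small: "eH * 2 ^ (card (\<Union>H) + 2) * c \<le> exp (- 3) / 2"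
    and K: "3 \<le> \<epsilon> * real K" and R: "ln (real n) \<le> real R"
  shows "weight ((\<Union>r\<in>{..R}. level r K) \<union> (\<Union>d\<in>{..<K}. level R d))
    \<le> 2 ^ card (\<Union>H) * (4 * (vH + 1) * 2 ^ card (\<Union>H) * vH ^ card (\<Union>H)) ^ K
       * (Y ^ Suc (2 * (K * card (\<Union>H))) / real n)"
proof -
  define v where "v = card (\<Union>H)"
  \<comment> \<open>The half compensates the factor 2 per round in
    \<open>level_weight\<close>.\<close>
  define \<alpha> :: real where "\<alpha> = exp (- 3) / 2"
  define X where "X = real (1 + 2 * (R + K))"
  define D where "D = 4 * (vH + 1) * 2 ^ v * vH ^ v"
  have XY: "X + 1 = Y" "1 \<le> X" "X \<le> Y" "1 \<le> Y" by (simp_all add: X_def Y_def)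
  have v: "4 \<le> v" "4 \<le> vH" using v_ge_4 by (simp_all add: v_def)
  have "exp (- 3 :: real) \<le> 2" by (rule order_trans[of _ 1]) simp_all
  then have \<alpha>: "0 < \<alpha>" "\<alpha> \<le> 1" "2 * \<alpha> = exp (- 3)" by (simp_all add: \<alpha>_def)
  have "c ^ (card H - 1) \<le> c ^ 1" using c five_edges by (intro power_decreasing) auto
  then have "rho \<le> 2 ^ (card (\<Union>H) + 2) * c" by (simp add: rho_def)
  then have "eH * rho \<le> eH * (2 ^ (card (\<Union>H) + 2) * c)" by (intro mult_left_mono) auto
  then have er: "eH * rho \<le> \<alpha>" using small by (simp add: \<alpha>_def mult.assoc)
  have er0: "0 \<le> eH * rho" using rho_nonneg by simp
  have "eH\<^sup>2 * rho\<^sup>2 = (eH * rho) * (eH * rho)" by (simp add: power2_eq_square)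
  also have "\<dots> \<le> \<alpha> * 1" using er er0 \<alpha> by (intro mult_mono) auto
  finally have \<alpha>2: "eH\<^sup>2 * rho\<^sup>2 \<le> \<alpha>" by simp
  have \<Gamma>: "eH * X * rho \<le> \<alpha> * X" using mult_right_mono[OF er, of X] XY by (simp add: mult_ac)
  have d0: "0 \<le> delta0 (vH * (X + 1))" using XY by (simp add: delta0_def)
  have \<delta>: "(1 + eH * rho) * delta0 (vH * (X + 1)) \<le> 2 * delta0 (vH * (X + 1))"
    using er \<alpha> d0 by (intro mult_right_mono) auto
  have dD: "2 * (2 * delta0 (vH * (X + 1))) = D * Y ^ v * real n powr (- \<epsilon>)"
    unfolding delta0_def XY(1) by (simp add: D_def v_def power_mult_distrib)
  have D1: "1 \<le> D * Y ^ v"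
  proof -
    have "1 \<le> 4 * (vH + 1)" "(1::real) \<le> 2 ^ v" "1 \<le> vH ^ v" "1 \<le> Y ^ v"
      using v(2) XY(4) by (simp_all add: one_le_power)
    then have "1 * 1 * 1 * 1 \<le> 4 * (vH + 1) * 2 ^ v * vH ^ v * Y ^ v"
      using v(2) by (intro mult_mono mult_nonneg_nonneg) auto
    then show ?thesis by (simp add: D_def)
  qed
  have ne: "0 < real n powr (- \<epsilon>)" "real n powr (- \<epsilon>) \<le> 1"
    using n eps powr_mono[of "- \<epsilon>" 0 "real n"] by auto
  define M where "M = 2 ^ v * D ^ K * (Y ^ (2 * (K * v)) / real n)"
  have M: "M = 2 ^ v * (D * Y ^ v) ^ K * Y ^ (K * v) * ((real n)\<^sup>2 * real n powr (- 3))"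
  proof -
    have "real n powr (- 3) = inverse (real n ^ 3)" using n by (simp add: powr_minus powr_numeral)
    then have "(real n)\<^sup>2 * real n powr (- 3) = 1 / real n"
      using n by (simp add: field_simps eval_nat_numeral)
    moreover have "(D * Y ^ v) ^ K * Y ^ (K * v) = D ^ K * Y ^ (2 * (K * v))"
      by (simp add: power_mult_distrib power_mult[symmetric] power_add[symmetric] mult_2 mult.commute[of v K])
    ultimately show ?thesis unfolding M_def by simp
  qed
  have level: "weight (level r d) \<le> 2 ^ v * (real n)\<^sup>2 * exp (- 3) ^ r
      * (D * Y ^ v * real n powr (- \<epsilon>)) ^ d * Y ^ (K * v)" if rd: "r \<le> R" "d \<le> K" for r d
  proof -
    have "weight (level r d) \<le> 2 ^ card (\<Union>H) * (real n)\<^sup>2 * (2 * \<alpha>) ^ r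
        * (2 * (2 * delta0 (vH * (X + 1)))) ^ d * X ^ min r (d * card (\<Union>H))"
      using \<alpha> \<alpha>2 XY \<Gamma> \<delta> rd unfolding X_def by (intro level_weight) auto
    also have "\<dots> \<le> 2 ^ card (\<Union>H) * (real n)\<^sup>2 * (2 * \<alpha>) ^ r
        * (2 * (2 * delta0 (vH * (X + 1)))) ^ d * Y ^ (K * v)"
    proof (rule mult_left_mono)
      have "X ^ min r (d * card (\<Union>H)) \<le> Y ^ min r (d * card (\<Union>H))" using XY by (intro power_mono) auto
      also have "\<dots> \<le> Y ^ (K * v)"
        using XY rd by (intro power_increasing) (auto simp: v_def min.coboundedI2)
      finally show "X ^ min r (d * card (\<Union>H)) \<le> Y ^ (K * v)" .
    qed (use \<alpha> d0 in simp)
    finally show ?thesis unfolding dD \<alpha>(3) v_def .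
  qed
  have down: "weight (level r K) \<le> M" if r: "r \<le> R" for r
  proof -
    have "(real n powr (- \<epsilon>)) ^ K = real n powr (- (\<epsilon> * real K))"
      using n by (simp add: powr_realpow[symmetric] powr_powr)
    also have "\<dots> \<le> real n powr (- 3)" using K n by (intro powr_mono) auto
    finally have nK: "(real n powr (- \<epsilon>)) ^ K \<le> real n powr (- 3)" .
    have "weight (level r K) \<le> 2 ^ v * (real n)\<^sup>2 * exp (- 3) ^ r
      * (D * Y ^ v * real n powr (- \<epsilon>)) ^ K * Y ^ (K * v)" using level r by simp
    also have "\<dots> = (2 ^ v * (D * Y ^ v) ^ K * Y ^ (K * v)) * (exp (- 3) ^ r * ((real n)\<^sup>2 * (real n powr (- \<epsilon>)) ^ K))"
      by (simp add: power_mult_distrib)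
    also have "\<dots> \<le> (2 ^ v * (D * Y ^ v) ^ K * Y ^ (K * v)) * (1 * ((real n)\<^sup>2 * real n powr (- 3)))"
      using nK D1 XY by (intro mult_mono power_le_one) auto
    also have "\<dots> = M" unfolding M by simp
    finally show ?thesis .
  qed
  have up: "weight (level R d) \<le> M" if d: "d < K" for d
  proof -
    have "exp (- 3) ^ R = exp (- 3 * real R)" by (simp add: exp_of_nat_mult[symmetric] mult.commute)
    also have "\<dots> \<le> exp (- 3 * ln (real n))" using R by simp
    also have "\<dots> = real n powr (- 3)" using n by (simp add: powr_def)
    finally have eR: "exp (- 3) ^ R \<le> real n powr (- 3)" .
    \<comment> \<open>The savings of fewer than K degenerate rounds are discarded; the R regular
      rounds suffice on their own.\<close>
    have "(D * Y ^ v * real n powr (- \<epsilon>)) ^ d \<le> (D * Y ^ v) ^ d"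
      using ne D1 by (intro power_mono) (auto intro: mult_left_le)
    also have "\<dots> \<le> (D * Y ^ v) ^ K" using D1 d by (intro power_increasing) auto
    finally have dK: "(D * Y ^ v * real n powr (- \<epsilon>)) ^ d \<le> (D * Y ^ v) ^ K" .
    have "weight (level R d) \<le> 2 ^ v * (real n)\<^sup>2 * exp (- 3) ^ R
      * (D * Y ^ v * real n powr (- \<epsilon>)) ^ d * Y ^ (K * v)" using level d by simp
    also have "\<dots> \<le> 2 ^ v * (real n)\<^sup>2 * real n powr (- 3) * (D * Y ^ v) ^ K * Y ^ (K * v)"
      using eR dK D1 XY by (intro mult_mono) auto
    also have "\<dots> = M" unfolding M by simp
    finally show ?thesis .
  qed
  let ?A = "\<Union>r\<in>{..R}. level r K" and ?B = "\<Union>d\<in>{..<K}. level R d"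
  have "weight ?A \<le> (\<Sum>r\<in>{..R}. M)"
    using down finite_level by (intro weight_UN[OF _ _ subset_refl]) auto
  moreover have "weight ?B \<le> (\<Sum>d\<in>{..<K}. M)"
    using up finite_level by (intro weight_UN[OF _ _ subset_refl]) auto
  moreover have "weight (?A \<union> ?B) \<le> weight ?A + weight ?B"
    using finite_level by (intro weight_Un_le) auto
  ultimately have "weight (?A \<union> ?B) \<le> (real R + 1 + real K) * M" by (simp add: algebra_simps)
  also have "\<dots> \<le> Y * M"
  proof (rule mult_right_mono)
    have "0 \<le> D" using v by (simp add: D_def)
    then show "0 \<le> M" using XY by (simp add: M_def)
  qed (simp add: Y_def)
  finally show ?thesis by (simp add: M_def D_def v_def mult_ac)
qed

section \<open>Bounded sets denser than \<open>m\<close>\<close>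

definition dense_sets :: "nat \<Rightarrow> nat set set set" where
  "dense_sets B = {J \<in> inside. card (\<Union>J) \<le> B \<and> m * real (card (\<Union>J)) < real (card J)}"

text \<open>For fixed k and l there are at most \<open>n ^ k\<close> vertex sets and
  \<open>2 ^ 2 ^ B\<close> families of subsets on each. All exponents on the right are negative, and
  the index set does not depend on n, so the sum tends to 0.\<close>

lemma dense_weight:
  "weight (dense_sets B) \<le> (\<Sum>(k,l)\<in>{(k,l). k \<le> B \<and> l \<le> 2 ^ B \<and> m * real k < real l}.
     2 ^ 2 ^ B * real n powr (real k - real l / m))"
proof -
  define I where "I = {(k,l). k \<le> B \<and> l \<le> 2 ^ B \<and> m * real k < real l}"
  define A where "A = (\<lambda>(k,l). {J \<in> inside. card (\<Union>J) = k \<and> card J = l})"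
  have finI: "finite I"
    by (rule finite_subset[of _ "{..B} \<times> {..2 ^ B}"]) (auto simp: I_def)
  have finA: "finite (A x)" for x
    by (rule finite_subset[OF _ finite_inside]) (auto simp: A_def)
  have UJ: "\<Union>J \<subseteq> {..<n}" if "J \<in> inside" for J
    using that by (auto simp: potential_edges_def)
  have cardJ: "card J \<le> 2 ^ card (\<Union>J)" if "J \<in> inside" for J
  proof -
    have "finite (\<Union>J)" using UJ[OF that] finite_subset by blast
    then have "card J \<le> card (Pow (\<Union>J))" by (intro card_mono) auto
    then show ?thesis using \<open>finite (\<Union>J)\<close> by (simp add: card_Pow)
  qed
  have "weight (dense_sets B) \<le> (\<Sum>x\<in>I. (\<lambda>(k,l). 2 ^ 2 ^ B * real n powr (real k - real l / m)) x)"
  proof (rule weight_UN[OF finI finA])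
    show "dense_sets B \<subseteq> (\<Union>x\<in>I. A x)"
    proof
      fix J assume J: "J \<in> dense_sets B"
      then have "card J \<le> 2 ^ card (\<Union>J)" using cardJ by (simp add: dense_sets_def)
      also have "\<dots> \<le> 2 ^ B" using J by (intro power_increasing) (auto simp: dense_sets_def)
      finally have "(card (\<Union>J), card J) \<in> I" using J by (simp add: I_def dense_sets_def)
      moreover have "J \<in> A (card (\<Union>J), card J)" using J by (simp add: A_def dense_sets_def)
      ultimately show "J \<in> (\<Union>x\<in>I. A x)" by blast
    qed
  next
    fix x assume x: "x \<in> I"
    obtain k l where kl: "x = (k,l)" by (cases x)
    have k: "k \<le> B" using x kl by (simp add: I_def)
    have "card (A x) \<le> card (\<Union>V\<in>{V. V \<subseteq> {..<n} \<and> card V = k}. Pow (Pow V))"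
    proof (rule card_mono)
      have "finite V" if "V \<subseteq> {..<n}" for V using that finite_subset by blast
      then show "finite (\<Union>V\<in>{V. V \<subseteq> {..<n} \<and> card V = k}. Pow (Pow V))" by simp
      show "A x \<subseteq> (\<Union>V\<in>{V. V \<subseteq> {..<n} \<and> card V = k}. Pow (Pow V))"
      proof
        fix J assume "J \<in> A x"
        then have "J \<in> inside" "card (\<Union>J) = k" by (simp_all add: A_def kl)
        then have "\<Union>J \<in> {V. V \<subseteq> {..<n} \<and> card V = k}" using UJ by blast
        moreover have "J \<in> Pow (Pow (\<Union>J))" by blast
        ultimately show "J \<in> (\<Union>V\<in>{V. V \<subseteq> {..<n} \<and> card V = k}. Pow (Pow V))" by (rule UN_I)
      qed
    qed
    also have "\<dots> \<le> (\<Sum>V\<in>{V. V \<subseteq> {..<n} \<and> card V = k}. card (Pow (Pow V)))"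
      by (intro card_UN_le) simp
    also have "\<dots> = (\<Sum>V\<in>{V. V \<subseteq> {..<n} \<and> card V = k}. 2 ^ 2 ^ k)"
    proof (intro sum.cong refl)
      fix V assume V: "V \<in> {V. V \<subseteq> {..<n} \<and> card V = k}"
      then have "finite V" using finite_subset by blast
      then show "card (Pow (Pow V)) = 2 ^ 2 ^ k" using V by (simp add: card_Pow)
    qed
    also have "\<dots> = (n choose k) * 2 ^ 2 ^ k" by (simp add: n_subsets)
    also have "\<dots> \<le> n ^ k * 2 ^ 2 ^ B"
    proof (rule mult_le_mono)
      show "n choose k \<le> n ^ k" using binomial_le_pow[of k n] by (cases "k \<le> n") (simp_all add: binomial_eq_0)
      show "(2::nat) ^ 2 ^ k \<le> 2 ^ 2 ^ B" using k by (intro power_increasing) auto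
    qed
    finally have "real (card (A x)) \<le> real (n ^ k * 2 ^ 2 ^ B)" by (simp only: of_nat_le_iff)
    then have cA: "real (card (A x)) \<le> real n ^ k * 2 ^ 2 ^ B" by simp
    have "weight (A x) = real (card (A x)) * q ^ l"
      unfolding weight_def by (simp add: A_def kl)
    also have "\<dots> \<le> (real n ^ k * 2 ^ 2 ^ B) * real n powr (- real l / m)"
      using cA q_power_le q_nonneg by (intro mult_mono) auto
    also have "\<dots> = 2 ^ 2 ^ B * real n powr (real k - real l / m)"
      by (simp add: n_power powr_add[symmetric])
    finally show "weight (A x) \<le> (\<lambda>(k,l). 2 ^ 2 ^ B * real n powr (real k - real l / m)) x"
      by (simp add: kl)
  qed
  then show ?thesis by (simp add: I_def)
qed

end

section \<open>Random graphs\<close>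

lemma finite_subgraphs:
  assumes "finite_simple_graph G"
  shows "finite {J. subgraph J G}"
proof -
  have fin: "finite (verts G)" using assms by (simp add: finite_simple_graph_def)
  have "edges G \<subseteq> Pow (verts G)" using assms by (auto simp: finite_simple_graph_def)
  then have "finite (edges G)" using fin finite_subset by blast
  moreover have "{J. subgraph J G} \<subseteq> (\<lambda>(V,E). SGraph V E) ` (Pow (verts G) \<times> Pow (edges G))"
  proof
    fix J assume "J \<in> {J. subgraph J G}"
    then have "J = (\<lambda>(V,E). SGraph V E) (verts J, edges J)"
      "(verts J, edges J) \<in> Pow (verts G) \<times> Pow (edges G)" by (auto simp: subgraph_def)
    then show "J \<in> (\<lambda>(V,E). SGraph V E) ` (Pow (verts G) \<times> Pow (edges G))" by (rule image_eqI)
  qed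
  ultimately show ?thesis using fin by (meson finite_SigmaI finite_Pow_iff finite_imageI finite_subset)
qed

lemma card_verts_ge_3:
  assumes "finite_simple_graph G" "2 \<le> card (edges G)"
  shows "3 \<le> card (verts G)"
proof (rule ccontr)
  assume *: "\<not> ?thesis"
  have fin: "finite (verts G)" using assms by (simp add: finite_simple_graph_def)
  have "e = verts G" if "e \<in> edges G" for e
    using that assms * fin by (intro card_seteq) (auto simp: finite_simple_graph_def)
  then have "edges G \<subseteq> {verts G}" by blast
  then have "card (edges G) \<le> card {verts G}" by (rule card_mono[rotated]) simp
  then show False using assms(2) by simp
qed

lemma d2_eq:
  assumes "finite_simple_graph G" "2 \<le> card (edges G)"
  shows "d2 G = (real (card (edges G)) - 1) / (real (card (verts G)) - 2)"
  using card_verts_ge_3[OF assms] assms(2) by (simp add: d2_def)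

text \<open>Deleting isolated vertices would give a proper subgraph of larger \<open>d2\<close>, so
  a strictly balanced graph has none and is determined by its edges. The maximum \<open>m2 H\<close>
  is attained at H itself, which turns balancedness into the density conditions of
  \<open>pattern\<close>.\<close>

lemma pattern_of_graph:
  fixes H :: "'a sgraph"
  assumes fsg: "finite_simple_graph H" and bal: "strictly_2_balanced H"
    and e5: "5 \<le> card (edges H)" and m2: "1 < m2 H"
  shows "verts H = \<Union>(edges H)" "pattern (edges H) (m2 H)"
proof -
  have fin: "finite (verts H)" "finite (edges H)"
    using fsg e5 card.infinite[of "edges H"] by (fastforce simp: finite_simple_graph_def)+
  have E: "\<And>e. e \<in> edges H \<Longrightarrow> e \<subseteq> verts H \<and> card e = 2" using fsg by (simp add: finite_simple_graph_def)
  have self: "subgraph H H" using fsg by (simp add: subgraph_def)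
  have v3: "3 \<le> card (verts H)" using card_verts_ge_3[OF fsg] e5 by simp
  have d2H: "d2 H = (real (card (edges H)) - 1) / (real (card (verts H)) - 2)"
    using d2_eq[OF fsg] e5 by simp
  have less: "(real (card A) - 1) / (real (card (\<Union>A)) - 2) < d2 H"
    if A: "A \<subseteq> edges H" "2 \<le> card A" "SGraph (\<Union>A) A \<noteq> H" for A
  proof -
    have "finite (\<Union>A)" by (rule finite_subset[OF _ fin(1)]) (use A E in blast)
    then have fA: "finite_simple_graph (SGraph (\<Union>A) A)"
      using A E by (auto simp: finite_simple_graph_def)
    then have "subgraph (SGraph (\<Union>A) A) H" using A E by (auto simp: subgraph_def)
    then have "d2 (SGraph (\<Union>A) A) < d2 H" using bal A by (simp add: strictly_2_balanced_def)
    then show ?thesis using d2_eq[OF fA] A by simp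
  qed
  have UE: "\<Union>(edges H) \<subseteq> verts H" using E by blast
  have fUE: "finite_simple_graph (SGraph (\<Union>(edges H)) (edges H))"
    using E finite_subset[OF UE fin(1)] by (auto simp: finite_simple_graph_def)
  have v3': "3 \<le> card (\<Union>(edges H))" using card_verts_ge_3[OF fUE] e5 by simp
  show VE: "verts H = \<Union>(edges H)"
  proof (rule ccontr)
    assume "verts H \<noteq> \<Union>(edges H)"
    then have ps: "\<Union>(edges H) \<subset> verts H" and ne: "SGraph (\<Union>(edges H)) (edges H) \<noteq> H"
      using UE by (auto, metis sgraph.sel(1))
    have "card (\<Union>(edges H)) < card (verts H)" by (rule psubset_card_mono[OF fin(1) ps])
    then have "d2 H \<le> (real (card (edges H)) - 1) / (real (card (\<Union>(edges H))) - 2)"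
      unfolding d2H using v3' e5 by (intro divide_left_mono mult_pos_pos) auto
    moreover have "(real (card (edges H)) - 1) / (real (card (\<Union>(edges H))) - 2) < d2 H"
      using e5 ne by (intro less) auto
    ultimately show False by simp
  qed
  have "{d2 J |J. subgraph J H} = d2 ` {J. subgraph J H}" by blast
  then have "m2 H = Max (d2 ` {J. subgraph J H})" by (simp add: m2_def)
  also have "\<dots> = d2 H"
  proof (rule Max_eqI)
    fix y assume "y \<in> d2 ` {J. subgraph J H}"
    then obtain J where "subgraph J H" "y = d2 J" by blast
    then show "y \<le> d2 H" using bal by (cases "J = H") (auto simp: strictly_2_balanced_def intro: less_imp_le)
  qed (use finite_subgraphs[OF fsg] self in auto)
  finally have m: "m2 H = d2 H" .
  show "pattern (edges H) (m2 H)"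
  proof
    show "real (card (edges H)) - 1 = m2 H * (real (card (\<Union>(edges H))) - 2)"
      using v3 unfolding m d2H VE[symmetric] by simp
  next
    fix A assume A: "A \<subset> edges H" "2 \<le> card A"
    then have ne: "SGraph (\<Union>A) A \<noteq> H" by auto
    have "finite (\<Union>A)" by (rule finite_subset[OF _ fin(1)]) (use A E in blast)
    then have fA: "finite_simple_graph (SGraph (\<Union>A) A)"
      using A E by (auto simp: finite_simple_graph_def)
    have "3 \<le> card (\<Union>A)" using card_verts_ge_3[OF fA] A by simp
    then show "real (card A) - 1 < m2 H * (real (card (\<Union>A)) - 2)"
      using less[OF _ A(2) ne] A(1) unfolding m by (simp add: pos_divide_less_eq psubset_imp_subset)
  qed (use fin E e5 m2 in auto)
qed

context pattern begin

lemma anti_ramsey_iff_rainbow_forced: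
  fixes G :: "'a sgraph" and E :: "nat set set"
  assumes G: "edges G = H" "verts G = \<Union>H"
    and V: "finite V" "\<And>e. e \<in> E \<Longrightarrow> e \<subseteq> V \<and> card e = 2"
  shows "anti_ramsey (SGraph V E) G \<longleftrightarrow> rainbow_forced E"
proof -
  have copy: "(\<exists>J. subgraph J (SGraph V E) \<and> isomorphic J G \<and> P (edges J))
      \<longleftrightarrow> (\<exists>C\<in>copies. C \<subseteq> E \<and> P C)" for P
  proof
    assume "\<exists>J. subgraph J (SGraph V E) \<and> isomorphic J G \<and> P (edges J)"
    then obtain J f where J: "finite_simple_graph J" "edges J \<subseteq> E" "P (edges J)"
      and f: "bij_betw f (verts J) (\<Union>H)" "H = (\<lambda>e. f ` e) ` edges J"
      by (auto simp: subgraph_def isomorphic_def G)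
    define \<phi> where "\<phi> = inv_into (verts J) f"
    have "inj_on \<phi> (\<Union>H)" using bij_betw_imp_inj_on[OF bij_betw_inv_into[OF f(1)]] by (simp add: \<phi>_def)
    moreover have inv: "\<phi> ` f ` e = e" if "e \<in> edges J" for e
    proof -
      have "e \<subseteq> verts J" using J(1) that by (simp add: finite_simple_graph_def)
      then show ?thesis unfolding \<phi>_def using f(1) by (intro inv_into_image_cancel) (auto simp: bij_betw_def)
    qed
    then have "edges J = (\<lambda>e. \<phi> ` e) ` H" unfolding f(2) image_image by simp
    ultimately have "edges J \<in> copies" unfolding copies_def by blast
    then show "\<exists>C\<in>copies. C \<subseteq> E \<and> P C" using J by blast
  next
    assume "\<exists>C\<in>copies. C \<subseteq> E \<and> P C"
    then obtain C where C: "C \<in> copies" "C \<subseteq> E" "P C" by blast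
    obtain \<phi> where \<phi>: "inj_on \<phi> (\<Union>H)" "C = (\<lambda>e. \<phi> ` e) ` H" using C(1) by (rule copyE)
    define J where "J = SGraph (\<Union>C) C"
    define f where "f = inv_into (\<Union>H) \<phi>"
    have UC: "\<Union>C = \<phi> ` \<Union>H" using \<phi>(2) by blast
    have "\<Union>C \<subseteq> V" using C(2) V(2) by blast
    then have "subgraph J (SGraph V E)"
      using C card_edge_copy[OF C(1)] finite_Union_copy[OF C(1)]
      by (auto simp: J_def subgraph_def finite_simple_graph_def)
    moreover have "bij_betw \<phi> (\<Union>H) (\<Union>C)" using \<phi>(1) UC by (simp add: bij_betw_def)
    then have "bij_betw f (\<Union>C) (\<Union>H)" unfolding f_def by (rule bij_betw_inv_into)
    moreover have inv: "f ` \<phi> ` e = e" if "e \<in> H" for e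
      unfolding f_def using that by (intro inv_into_image_cancel \<phi>(1)) blast
    then have "H = (\<lambda>e. f ` e) ` C" unfolding \<phi>(2) image_image by simp
    ultimately have "subgraph J (SGraph V E) \<and> isomorphic J G"
      unfolding isomorphic_def G by (auto simp: J_def)
    then show "\<exists>J. subgraph J (SGraph V E) \<and> isomorphic J G \<and> P (edges J)"
      using C(3) by (intro exI[of _ J]) (simp add: J_def)
  qed
  show ?thesis
    unfolding anti_ramsey_def rainbow_forced_def proper_edge_colouring_def proper_on_def copy by simp
qed

end

text \<open>From a densest subgraph only the edges are kept: dropping its isolated vertices can only
  lower the left side, as \<open>0 \<le> x\<close>.\<close>

lemma max_density_gt:
  assumes fsg: "finite_simple_graph G" and ne: "verts G \<noteq> {}" and gt: "x < max_density G" and x: "0 \<le> x"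
  shows "\<exists>A\<subseteq>edges G. x * real (card (\<Union>A)) < real (card A)"
proof -
  define h :: "'a sgraph \<Rightarrow> real" where "h J = real (card (edges J)) / real (card (verts J))" for J
  define \<J> where "\<J> = {J. subgraph J G \<and> 1 \<le> card (verts J)}"
  have fin: "finite \<J>"
    by (rule finite_subset[OF _ finite_subgraphs[OF fsg]]) (auto simp: \<J>_def)
  have "finite (verts G)" using fsg by (simp add: finite_simple_graph_def)
  then have "G \<in> \<J>" using fsg ne by (auto simp: \<J>_def subgraph_def Suc_le_eq card_gt_0_iff)
  then have "Max (h ` \<J>) \<in> h ` \<J>" using fin by (intro Max_in) auto
  moreover have "max_density G = Max (h ` \<J>)"
    unfolding max_density_def by (rule arg_cong[of _ _ Max]) (auto simp: h_def \<J>_def)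
  ultimately obtain J where J: "J \<in> \<J>" "x < h J" using gt by auto
  then have "x * real (card (verts J)) < real (card (edges J))"
    by (simp add: \<J>_def h_def pos_less_divide_eq)
  moreover have "\<Union>(edges J) \<subseteq> verts J" "finite (verts J)"
    using J(1) by (auto simp: \<J>_def subgraph_def finite_simple_graph_def)
  then have "x * real (card (\<Union>(edges J))) \<le> x * real (card (verts J))"
    using x by (intro mult_left_mono) (auto simp: card_mono)
  moreover have "edges J \<subseteq> edges G" using J(1) by (simp add: \<J>_def subgraph_def)
  ultimately show ?thesis by (intro exI[of _ "edges J"]) auto
qed

section \<open>The union bound in the random graph and the limits\<close>

lemma prob_edges_present:
  assumes "finite A" "S \<subseteq> A" "0 \<le> p" "p \<le> 1"
  shows "measure_pmf.prob (Pi_pmf A False (\<lambda>_. bernoulli_pmf p)) {\<omega>. \<forall>e\<in>S. \<omega> e} = p ^ card S"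
proof -
  define B where "B = (\<lambda>e. if e \<in> S then {True} else UNIV)"
  have "{\<omega>. \<forall>e\<in>S. \<omega> e} = Pi A B" using assms(2) by (auto simp: B_def Pi_def split: if_splits)
  then have "measure_pmf.prob (Pi_pmf A False (\<lambda>_. bernoulli_pmf p)) {\<omega>. \<forall>e\<in>S. \<omega> e}
      = (\<Prod>e\<in>A. measure_pmf.prob (bernoulli_pmf p) (B e))"
    using measure_Pi_pmf_Pi[OF assms(1)] by simp
  also have "\<dots> = (\<Prod>e\<in>A. if e \<in> S then p else 1)"
    using assms by (intro prod.cong) (auto simp: B_def measure_pmf_single)
  also have "\<dots> = (\<Prod>e\<in>S. p)"
    using assms by (subst prod.If_cases) (auto simp: Int_absorb1)
  finally show ?thesis by simp
qed

lemma random_graph_union_bound: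
  assumes fin: "finite \<F>" and sub: "\<And>S. S \<in> \<F> \<Longrightarrow> S \<subseteq> potential_edges n"
    and p: "0 \<le> p" "p \<le> 1"
    and cover: "\<And>E. E \<subseteq> potential_edges n \<Longrightarrow> SGraph {..<n} E \<in> \<A> \<Longrightarrow> \<exists>S\<in>\<F>. S \<subseteq> E"
  shows "measure_pmf.prob (random_graph n p) \<A> \<le> (\<Sum>S\<in>\<F>. p ^ card S)"
proof -
  let ?P = "Pi_pmf (potential_edges n) False (\<lambda>_. bernoulli_pmf p)"
  have finE: "finite (potential_edges n)"
    by (rule finite_subset[of _ "Pow {..<n}"]) (auto simp: potential_edges_def)
  have "measure_pmf.prob (random_graph n p) \<A>
      = measure_pmf.prob ?P {\<omega>. SGraph {..<n} {e \<in> potential_edges n. \<omega> e} \<in> \<A>}"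
    by (simp add: random_graph_def vimage_def)
  also have "\<dots> \<le> measure_pmf.prob ?P (\<Union>S\<in>\<F>. {\<omega>. \<forall>e\<in>S. \<omega> e})"
  proof (rule measure_pmf.finite_measure_mono)
    show "{\<omega>. SGraph {..<n} {e \<in> potential_edges n. \<omega> e} \<in> \<A>} \<subseteq> (\<Union>S\<in>\<F>. {\<omega>. \<forall>e\<in>S. \<omega> e})"
    proof
      fix \<omega> assume "\<omega> \<in> {\<omega>. SGraph {..<n} {e \<in> potential_edges n. \<omega> e} \<in> \<A>}"
      then have "\<exists>S\<in>\<F>. S \<subseteq> {e \<in> potential_edges n. \<omega> e}" by (intro cover) auto
      then show "\<omega> \<in> (\<Union>S\<in>\<F>. {\<omega>. \<forall>e\<in>S. \<omega> e})" by blast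
    qed
  qed simp
  also have "\<dots> \<le> (\<Sum>S\<in>\<F>. measure_pmf.prob ?P {\<omega>. \<forall>e\<in>S. \<omega> e})"
    using fin by (intro measure_pmf.finite_measure_subadditive_finite) auto
  also have "\<dots> = (\<Sum>S\<in>\<F>. p ^ card S)"
    using prob_edges_present[OF finE sub p] by simp
  finally show ?thesis .
qed

text \<open>With \<open>x = b / 2 + ln n\<close> the expression is a constant times
  \<open>x ^ k / exp x\<close>.\<close>

lemma log_power_over_n: "(\<lambda>n::nat. (2 * ln (real n) + b) ^ k / real n) \<longlonglongrightarrow> 0"
proof -
  have "filterlim (\<lambda>n::nat. b / 2 + ln (real n)) at_top sequentially"
    by (intro filterlim_tendsto_add_at_top[OF tendsto_const]
        filterlim_compose[OF ln_at_top filterlim_real_sequentially])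
  from filterlim_compose[OF tendsto_power_div_exp_0 this]
  have "(\<lambda>n. 2 ^ k * exp (b / 2) * ((b / 2 + ln (real n)) ^ k / exp (b / 2 + ln (real n)))) \<longlonglongrightarrow>
      2 ^ k * exp (b / 2) * 0"
    by (intro tendsto_mult tendsto_const)
  moreover have "\<forall>\<^sub>F n in sequentially.
      2 ^ k * exp (b / 2) * ((b / 2 + ln (real n)) ^ k / exp (b / 2 + ln (real n)))
      = (2 * ln (real n) + b) ^ k / real n"
    using eventually_ge_at_top[of 1]
  proof eventually_elim
    case (elim n)
    have "2 * ln (real n) + b = 2 * (b / 2 + ln (real n))" by simp
    then show ?case using elim by (simp only: power_mult_distrib exp_add) simp
  qed
  ultimately show ?thesis by (simp add: tendsto_cong)
qed

theorem theorem1p6: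
  fixes H :: "'a sgraph"
  assumes "finite_simple_graph H"
    and "strictly_2_balanced H"
    and "card (edges H) \<ge> 5"
    and "m2 H > 1"
    and "\<And>G :: nat sgraph. finite_simple_graph G \<Longrightarrow> max_density G \<le> m2 H
           \<Longrightarrow> \<not> anti_ramsey G H"
  shows "\<exists>c::real. c > 0 \<and>
    (\<forall>p :: nat \<Rightarrow> real.
       (\<forall>n. 0 \<le> p n \<and> p n \<le> 1) \<and>
       (\<forall>n\<ge>1. p n \<le> c * real n powr (- 1 / m2 H)) \<longrightarrow>
       (\<lambda>n. measure_pmf.prob (random_graph n (p n)) {G. anti_ramsey G H}) \<longlonglongrightarrow> 0)"
proof -
  define m where "m = m2 H"
  define v where "v = card (\<Union>(edges H))"
  have verts: "verts H = \<Union>(edges H)"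
    using pattern_of_graph(1)[OF assms(1-4)] .
  interpret pattern "edges H" m
    using pattern_of_graph(2)[OF assms(1-4)] by (simp add: m_def)
  obtain \<epsilon> where \<epsilon>: "0 < \<epsilon>" and gap: "\<forall>b\<in>{1..card (edges H)}. \<forall>u\<in>{..v}.
      real b - 1 < m * (real u - 2) \<longrightarrow> \<epsilon> \<le> (real u - 2) - (real b - 1) / m"
    using gap_exists unfolding v_def by blast
  \<comment> \<open>All constants are fixed before n: c gives equality in the smallness condition of
    \<open>exploration_weight\<close>, K makes \<open>n powr (- \<epsilon> * K)\<close> at most
    \<open>n powr (- 3)\<close>, and B is the vertex bound of the third exploration outcome. The
    successors keep K and R positive, as the exploration requires.\<close>
  define c :: real where "c = exp (- 3) / 2 / (real (card (edges H)) * 2 ^ (v + 2))"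
  define K :: nat where "K = Suc (nat \<lceil>3 / \<epsilon>\<rceil>)"
  define R where "R = (\<lambda>n::nat. Suc (nat \<lceil>ln (real n)\<rceil>))"
  define B where "B = v * (1 + 2 * (K * v + K))"
  have e0: "1 \<le> real (card (edges H)) * 2 ^ (v + 2)"
  proof -
    have "1 \<le> real (card (edges H))" "(1::real) \<le> 2 ^ (v + 2)"
      using five_edges by (simp, intro one_le_power, simp)
    then have "1 * 1 \<le> real (card (edges H)) * 2 ^ (v + 2)" by (intro mult_mono) auto
    then show ?thesis by simp
  qed
  have c_eq: "real (card (edges H)) * 2 ^ (v + 2) * c = exp (- 3) / 2"
    using five_edges by (auto simp: c_def)
  have c0: "0 < c" using five_edges by (auto simp: c_def intro!: divide_pos_pos mult_pos_pos)
  have "exp (- 3 :: real) \<le> 2" by (rule order_trans[of _ 1]) simp_all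
  then have c1: "c \<le> 1" using mult_right_mono[OF e0, of c] c0 unfolding c_eq by simp
  have K: "3 \<le> \<epsilon> * real K"
  proof -
    have "3 / \<epsilon> \<le> real K" unfolding K_def by linarith
    then show ?thesis using \<epsilon> by (simp add: field_simps)
  qed
  define I where "I = {(k::nat, l::nat). k \<le> B \<and> l \<le> 2 ^ B \<and> m * real k < real l}"
  define b1 where "b1 = (\<lambda>n::nat. 2 ^ v * (4 * (real v + 1) * 2 ^ v * real v ^ v) ^ K
      * (real (2 + 2 * (R n + K)) ^ Suc (2 * (K * v)) / real n))"
  define b2 where "b2 = (\<lambda>n::nat. \<Sum>(k,l)\<in>I. 2 ^ 2 ^ B * real n powr (real k - real l / m))"
  have bound: "measure_pmf.prob (random_graph n p) {G. anti_ramsey G H} \<le> b1 n + b2 n"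
    if n: "1 \<le> n" and p: "0 \<le> p" "p \<le> 1" "p \<le> c * real n powr (- 1 / m)" for n p
  proof -
    interpret weighted_pattern "edges H" m c \<epsilon> n
      by unfold_locales (use c0 c1 n \<epsilon> gap v_def in auto)
    define \<F>1 where "\<F>1 = (\<Union>r\<in>{..R n}. level r K) \<union> (\<Union>d\<in>{..<K}. level (R n) d)"
    define \<F> where "\<F> = \<F>1 \<union> dense_sets B"
    have fin1: "finite \<F>1" using finite_level by (auto simp: \<F>1_def)
    have fin2: "finite (dense_sets B)"
      by (rule finite_subset[OF _ finite_inside]) (auto simp: dense_sets_def)
    have "measure_pmf.prob (random_graph n p) {G. anti_ramsey G H} \<le> (\<Sum>S\<in>\<F>. p ^ card S)"
    proof (rule random_graph_union_bound)
      show "finite \<F>" using fin1 fin2 by (simp add: \<F>_def)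
      show "S \<subseteq> potential_edges n" if "S \<in> \<F>" for S
        using that by (auto simp: \<F>_def \<F>1_def level_def dense_sets_def)
      fix E assume E: "E \<subseteq> potential_edges n" "SGraph {..<n} E \<in> {G. anti_ramsey G H}"
      have edge: "e \<subseteq> {..<n} \<and> card e = 2" if "e \<in> potential_edges n" for e
        using that by (simp add: potential_edges_def)
      have "rainbow_forced E"
        using E edge anti_ramsey_iff_rainbow_forced[OF refl verts, of "{..<n}" E] by blast
      moreover have "finite E" using E(1) finite_potential_edges finite_subset by blast
      ultimately obtain E' where E': "E' \<subseteq> E" "critical E'" by (metis critical_subset)
      show "\<exists>S\<in>\<F>. S \<subseteq> E"
      proof (rule exploration_outcome[OF E'(2), of "R n" K])
        show "0 < R n" "0 < K" by (simp_all add: R_def K_def)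
      next
        fix r S assume "r \<le> R n" "reach r K S" "S \<subseteq> E'"
        then have "S \<in> level r K" "S \<subseteq> E" using E E' by (auto simp: level_def)
        then show "\<exists>S\<in>\<F>. S \<subseteq> E" using \<open>r \<le> R n\<close> by (auto simp: \<F>_def \<F>1_def)
      next
        fix d S assume "d < K" "reach (R n) d S" "S \<subseteq> E'"
        then have "S \<in> level (R n) d" "S \<subseteq> E" using E E' by (auto simp: level_def)
        then show "\<exists>S\<in>\<F>. S \<subseteq> E" using \<open>d < K\<close> by (auto simp: \<F>_def \<F>1_def)
      next
        \<comment> \<open>The density hypothesis is applied to the graph with edge set E' on all n
          vertices, which is itself anti-Ramsey. Its dense part A spans at most B vertices, so it is
          one of the rare bounded dense sets; \<open>n \<ge> 1\<close> ensures that the maximum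
          density is taken over a nonempty set.\<close>
        assume small: "card (\<Union>E') \<le> card (\<Union>(edges H)) * (1 + 2 * (K * card (\<Union>(edges H)) + K))"
        let ?G = "SGraph {..<n} E'"
        have fG: "finite_simple_graph ?G" using E E' edge by (auto simp: finite_simple_graph_def)
        have "rainbow_forced E'" using E'(2) by (simp add: critical_def)
        moreover have "\<And>e. e \<in> E' \<Longrightarrow> e \<subseteq> {..<n} \<and> card e = 2" using E E' edge by blast
        ultimately have "anti_ramsey ?G H"
          using anti_ramsey_iff_rainbow_forced[OF refl verts, of "{..<n}" E'] by simp
        then have "m < max_density ?G" using assms(5)[OF fG] by (force simp: m_def)
        moreover have "verts ?G \<noteq> {}" using n by (auto simp: lessThan_empty_iff)
        ultimately obtain A where A: "A \<subseteq> E'" "m * real (card (\<Union>A)) < real (card A)"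
          using max_density_gt[OF fG, of m] m_gt_1 by auto
        have "\<Union>E' \<subseteq> {..<n}" using E E' edge by blast
        then have "finite (\<Union>E')" using finite_subset by blast
        then have "card (\<Union>A) \<le> card (\<Union>E')" using A by (intro card_mono) auto
        then have "card (\<Union>A) \<le> B" using small unfolding B_def v_def by linarith
        then have "A \<in> dense_sets B" using A E E' by (auto simp: dense_sets_def)
        then show "\<exists>S\<in>\<F>. S \<subseteq> E" using A E' by (auto simp: \<F>_def)
      qed
    qed (use p in auto)
    also have "\<dots> \<le> weight \<F>"
      unfolding weight_def using p by (intro sum_mono power_mono) (auto simp: q_def)
    also have "\<dots> \<le> weight \<F>1 + weight (dense_sets B)"
      using fin1 fin2 by (intro weight_Un_le) (auto simp: \<F>_def)
    also have "weight \<F>1 \<le> b1 n"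
      unfolding \<F>1_def b1_def v_def
    proof (rule exploration_weight[OF _ K])
      show "ln (real n) \<le> real (R n)" unfolding R_def by linarith
    qed (use c_eq v_def in simp)
    also have "weight (dense_sets B) \<le> b2 n" unfolding b2_def I_def by (rule dense_weight)
    finally show ?thesis by simp
  qed
  have lim1: "b1 \<longlonglongrightarrow> 0"
  proof -
    define a :: real where "a = 2 ^ v * (4 * (real v + 1) * 2 ^ v * real v ^ v) ^ K"
    define k where "k = Suc (2 * (K * v))"
    have "(\<lambda>n. a * ((2 * ln (real n) + (6 + 2 * real K)) ^ k / real n)) \<longlonglongrightarrow> a * 0"
      by (intro tendsto_mult tendsto_const log_power_over_n)
    then have lim: "(\<lambda>n. a * ((2 * ln (real n) + (6 + 2 * real K)) ^ k / real n)) \<longlonglongrightarrow> 0" by simp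
    show ?thesis
    proof (rule tendsto_sandwich[OF _ _ tendsto_const lim])
      show "\<forall>\<^sub>F n in sequentially. 0 \<le> b1 n" by (simp add: b1_def)
      show "\<forall>\<^sub>F n in sequentially. b1 n \<le> a * ((2 * ln (real n) + (6 + 2 * real K)) ^ k / real n)"
        using eventually_ge_at_top[of 1]
      proof eventually_elim
        case (elim n)
        then have "0 \<le> ln (real n)" by simp
        \<comment> \<open>Rounding up and the successor give \<open>R n \<le> ln n + 2\<close>,
          whence the 6.\<close>
        then have "real (2 + 2 * (R n + K)) \<le> 2 * ln (real n) + (6 + 2 * real K)"
          unfolding R_def by (simp add: algebra_simps) linarith
        then have "real (2 + 2 * (R n + K)) ^ k \<le> (2 * ln (real n) + (6 + 2 * real K)) ^ k"
          by (rule power_mono) simp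
        then show ?case unfolding b1_def a_def k_def
          by (intro mult_left_mono divide_right_mono) auto
      qed
    qed
  qed
  have lim2: "b2 \<longlonglongrightarrow> 0"
  proof -
    have "(\<lambda>n. (\<lambda>(k,l). 2 ^ 2 ^ B * real n powr (real k - real l / m)) x) \<longlonglongrightarrow> 0" if "x \<in> I" for x
    proof -
      obtain k l where kl: "x = (k,l)" by (cases x)
      have "real k - real l / m < 0" using that m_gt_1 by (simp add: I_def kl field_simps)
      then have "(\<lambda>n. real n powr (real k - real l / m)) \<longlonglongrightarrow> 0"
        by (intro tendsto_neg_powr filterlim_real_sequentially)
      from tendsto_mult[OF tendsto_const this, of "2 ^ 2 ^ B"] show ?thesis by (simp add: kl)
    qed
    then have "(\<lambda>n. \<Sum>x\<in>I. (\<lambda>(k,l). 2 ^ 2 ^ B * real n powr (real k - real l / m)) x) \<longlonglongrightarrow> (\<Sum>x\<in>I. 0)"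
      by (rule tendsto_sum)
    then show ?thesis by (simp add: b2_def)
  qed
  show ?thesis
  proof (intro exI[of _ c] conjI allI impI c0)
    fix p :: "nat \<Rightarrow> real"
    assume p: "(\<forall>n. 0 \<le> p n \<and> p n \<le> 1) \<and> (\<forall>n\<ge>1. p n \<le> c * real n powr (- 1 / m2 H))"
    have lim: "(\<lambda>n. b1 n + b2 n) \<longlonglongrightarrow> 0" using tendsto_add[OF lim1 lim2] by simp
    show "(\<lambda>n. measure_pmf.prob (random_graph n (p n)) {G. anti_ramsey G H}) \<longlonglongrightarrow> 0"
    proof (rule tendsto_sandwich[OF _ _ tendsto_const lim])
      show "\<forall>\<^sub>F n in sequentially. 0 \<le> measure_pmf.prob (random_graph n (p n)) {G. anti_ramsey G H}"
        by simp
      show "\<forall>\<^sub>F n in sequentially.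
          measure_pmf.prob (random_graph n (p n)) {G. anti_ramsey G H} \<le> b1 n + b2 n"
        using eventually_ge_at_top[of 1]
      proof eventually_elim
        case (elim n)
        then show ?case using p by (intro bound) (auto simp: m_def)
      qed
    qed
  qed
qed

end
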